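(* Let $\mathcal{C}$ be a bicomplete (ordinary) category such that the pullback functor $\mathsf{pb} \colon \mathrm{Fun}(\Lambda, \mathcal{C}) \to \mathcal{C}$, sending a cospan to its pullback, is accessible (e.g. if $\mathcal{C}$ is presentable). Then, for every regular cardinal $\kappa$, every $\kappa$-cocompact object in $\mathcal{C}$ is subterminal.
   Context: Here $\Lambda$ is the cospan category $\bullet \to \bullet \leftarrow \bullet$. Bicomplete means having all small limits and colimits. A functor is accessible if it preserves $\lambda$-filtered colimits for some regular cardinal $\lambda$. An object $Y$ of a category $\mathcal{C}$ is $\kappa$-cocompact if it is $\kappa$-compact in $\mathcal{C}^{\mathrm{op}}$, i.e. $\mathrm{Hom}_{\mathcal{C}}(-,Y)$ sends $\kappa$-cofiltered limits in $\mathcal{C}$ to $\kappa$-filtered colimits of sets. An object $Y$ is subterminal if for every object $X$ there is at most one morphism $X \to Y$. A presentable category is what is often called a locally presentable category. *)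

theory Defs
  imports Main "HOL-Library.FuncSet"
begin

unbundle cardinal_syntax

section \<open>Categories, functors, natural transformations\<close>

record ('o, 'a) cat =
  Ob :: "'o set"
  Ar :: "'a set"
  src :: "'a \<Rightarrow> 'o"
  tgt :: "'a \<Rightarrow> 'o"
  ide :: "'o \<Rightarrow> 'a"
  cmp :: "'a \<Rightarrow> 'a \<Rightarrow> 'a"  (infixr "\<cdot>\<index>" 70)

definition hom :: "('o, 'a) cat \<Rightarrow> 'o \<Rightarrow> 'o \<Rightarrow> 'a set" where
  "hom C x y = {f \<in> Ar C. src C f = x \<and> tgt C f = y}"

locale category =
  fixes C :: "('o, 'a) cat" (structure)
  assumes src_Ob: "f \<in> Ar C \<Longrightarrow> src C f \<in> Ob C"
    and tgt_Ob: "f \<in> Ar C \<Longrightarrow> tgt C f \<in> Ob C"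
    and ide_hom: "x \<in> Ob C \<Longrightarrow> ide C x \<in> hom C x x"
    and cmp_hom: "\<lbrakk>f \<in> hom C x y; g \<in> hom C y z\<rbrakk> \<Longrightarrow> g \<cdot> f \<in> hom C x z"
    and ide_cmp: "f \<in> hom C x y \<Longrightarrow> ide C y \<cdot> f = f"
    and cmp_ide: "f \<in> hom C x y \<Longrightarrow> f \<cdot> ide C x = f"
    and cmp_assoc: "\<lbrakk>f \<in> hom C w x; g \<in> hom C x y; h \<in> hom C y z\<rbrakk>
      \<Longrightarrow> h \<cdot> (g \<cdot> f) = (h \<cdot> g) \<cdot> f"

definition opcat :: "('o, 'a) cat \<Rightarrow> ('o, 'a) cat" where
  "opcat C = \<lparr>Ob = Ob C, Ar = Ar C, src = tgt C, tgt = src C, ide = ide C,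
     cmp = (\<lambda>g f. f \<cdot>\<^bsub>C\<^esub> g)\<rparr>"

record ('o, 'a, 'p, 'b) cfunctor =
  fob :: "'o \<Rightarrow> 'p"
  far :: "'a \<Rightarrow> 'b"

text \<open>
  Functors and natural transformations are required to be \<open>undefined\<close> off their domain, so that
  two of them are equal as HOL values iff they are equal as functors or natural transformations.
\<close>

definition is_functor ::
  "('o, 'a) cat \<Rightarrow> ('p, 'b) cat \<Rightarrow> ('o, 'a, 'p, 'b) cfunctor \<Rightarrow> bool" where
  "is_functor C D F \<longleftrightarrow> category C \<and> category D
     \<and> fob F \<in> extensional (Ob C) \<and> far F \<in> extensional (Ar C)
     \<and> (\<forall>x\<in>Ob C. fob F x \<in> Ob D)
     \<and> (\<forall>f\<in>Ar C. far F f \<in> hom D (fob F (src C f)) (fob F (tgt C f)))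
     \<and> (\<forall>x\<in>Ob C. far F (ide C x) = ide D (fob F x))
     \<and> (\<forall>f\<in>Ar C. \<forall>g\<in>Ar C. src C g = tgt C f \<longrightarrow>
          far F (g \<cdot>\<^bsub>C\<^esub> f) = far F g \<cdot>\<^bsub>D\<^esub> far F f)"

definition fcomp ::
  "('o, 'a) cat \<Rightarrow> ('p, 'b, 'q, 'c) cfunctor \<Rightarrow> ('o, 'a, 'p, 'b) cfunctor
    \<Rightarrow> ('o, 'a, 'q, 'c) cfunctor" where
  "fcomp C G F = \<lparr>fob = restrict (\<lambda>x. fob G (fob F x)) (Ob C),
                  far = restrict (\<lambda>f. far G (far F f)) (Ar C)\<rparr>"

record ('o, 'a, 'p, 'b) nattrans =
  nsrc :: "('o, 'a, 'p, 'b) cfunctor"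
  ntgt :: "('o, 'a, 'p, 'b) cfunctor"
  ncomp :: "'o \<Rightarrow> 'b"

definition is_nattrans ::
  "('o, 'a) cat \<Rightarrow> ('p, 'b) cat \<Rightarrow> ('o, 'a, 'p, 'b) nattrans \<Rightarrow> bool" where
  "is_nattrans J C \<alpha> \<longleftrightarrow> is_functor J C (nsrc \<alpha>) \<and> is_functor J C (ntgt \<alpha>)
     \<and> ncomp \<alpha> \<in> extensional (Ob J)
     \<and> (\<forall>j\<in>Ob J. ncomp \<alpha> j \<in> hom C (fob (nsrc \<alpha>) j) (fob (ntgt \<alpha>) j))
     \<and> (\<forall>u\<in>Ar J. ncomp \<alpha> (tgt J u) \<cdot>\<^bsub>C\<^esub> far (nsrc \<alpha>) u
                 = far (ntgt \<alpha>) u \<cdot>\<^bsub>C\<^esub> ncomp \<alpha> (src J u))"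

definition Fun :: "('o, 'a) cat \<Rightarrow> ('p, 'b) cat
    \<Rightarrow> (('o, 'a, 'p, 'b) cfunctor, ('o, 'a, 'p, 'b) nattrans) cat" where
  "Fun J C = \<lparr>Ob = {F. is_functor J C F}, Ar = {\<alpha>. is_nattrans J C \<alpha>},
     src = nsrc, tgt = ntgt,
     ide = (\<lambda>F. \<lparr>nsrc = F, ntgt = F, ncomp = restrict (\<lambda>j. ide C (fob F j)) (Ob J)\<rparr>),
     cmp = (\<lambda>\<beta> \<alpha>. \<lparr>nsrc = nsrc \<alpha>, ntgt = ntgt \<beta>,
              ncomp = restrict (\<lambda>j. ncomp \<beta> j \<cdot>\<^bsub>C\<^esub> ncomp \<alpha> j) (Ob J)\<rparr>)\<rparr>"


section \<open>Limits and colimits\<close>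

definition is_cocone :: "('j, 'i) cat \<Rightarrow> ('o, 'a) cat \<Rightarrow> ('j, 'i, 'o, 'a) cfunctor
    \<Rightarrow> 'o \<Rightarrow> ('j \<Rightarrow> 'a) \<Rightarrow> bool" where
  "is_cocone J C D c \<gamma> \<longleftrightarrow> c \<in> Ob C \<and> (\<forall>j\<in>Ob J. \<gamma> j \<in> hom C (fob D j) c)
     \<and> (\<forall>u\<in>Ar J. \<gamma> (tgt J u) \<cdot>\<^bsub>C\<^esub> far D u = \<gamma> (src J u))"

definition is_colimit :: "('j, 'i) cat \<Rightarrow> ('o, 'a) cat \<Rightarrow> ('j, 'i, 'o, 'a) cfunctor
    \<Rightarrow> 'o \<Rightarrow> ('j \<Rightarrow> 'a) \<Rightarrow> bool" where
  "is_colimit J C D c \<gamma> \<longleftrightarrow> is_cocone J C D c \<gamma>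
     \<and> (\<forall>d \<delta>. is_cocone J C D d \<delta> \<longrightarrow>
          (\<exists>!h. h \<in> hom C c d \<and> (\<forall>j\<in>Ob J. h \<cdot>\<^bsub>C\<^esub> \<gamma> j = \<delta> j)))"

definition is_cone :: "('j, 'i) cat \<Rightarrow> ('o, 'a) cat \<Rightarrow> ('j, 'i, 'o, 'a) cfunctor
    \<Rightarrow> 'o \<Rightarrow> ('j \<Rightarrow> 'a) \<Rightarrow> bool" where
  "is_cone J C D c \<pi> \<longleftrightarrow> c \<in> Ob C \<and> (\<forall>j\<in>Ob J. \<pi> j \<in> hom C c (fob D j))
     \<and> (\<forall>u\<in>Ar J. far D u \<cdot>\<^bsub>C\<^esub> \<pi> (src J u) = \<pi> (tgt J u))"

definition is_limit :: "('j, 'i) cat \<Rightarrow> ('o, 'a) cat \<Rightarrow> ('j, 'i, 'o, 'a) cfunctor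
    \<Rightarrow> 'o \<Rightarrow> ('j \<Rightarrow> 'a) \<Rightarrow> bool" where
  "is_limit J C D c \<pi> \<longleftrightarrow> is_cone J C D c \<pi>
     \<and> (\<forall>d \<rho>. is_cone J C D d \<rho> \<longrightarrow>
          (\<exists>!h. h \<in> hom C d c \<and> (\<forall>j\<in>Ob J. \<pi> j \<cdot>\<^bsub>C\<^esub> h = \<rho> j)))"

text \<open>
  Limits are determined only up to isomorphism. A limit functor is a functor whose value at \<open>F\<close>
  carries a limit cone \<open>\<pi> F\<close> and whose value at \<open>\<alpha>\<close> is the morphism induced by \<open>\<alpha>\<close> on limits.
\<close>

definition is_limit_functor :: "('j, 'i) cat \<Rightarrow> ('o, 'a) cat
    \<Rightarrow> (('j, 'i, 'o, 'a) cfunctor, ('j, 'i, 'o, 'a) nattrans, 'o, 'a) cfunctor \<Rightarrow> bool" where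
  "is_limit_functor J C P \<longleftrightarrow> is_functor (Fun J C) C P
     \<and> (\<exists>\<pi>. (\<forall>F\<in>Ob (Fun J C). is_limit J C F (fob P F) (\<pi> F))
          \<and> (\<forall>\<alpha>\<in>Ar (Fun J C). \<forall>j\<in>Ob J.
                \<pi> (ntgt \<alpha>) j \<cdot>\<^bsub>C\<^esub> far P \<alpha> = ncomp \<alpha> j \<cdot>\<^bsub>C\<^esub> \<pi> (nsrc \<alpha>) j))"

datatype cospan_ob = Lft | Mid | Rgt

text \<open>The cospan category as a poset: an arrow is a pair of objects in the order relation.\<close>

definition cospan_cat :: "(cospan_ob, cospan_ob \<times> cospan_ob) cat" ("\<Lambda>") where
  "\<Lambda> = \<lparr>Ob = UNIV, Ar = {(x, y). x = y \<or> y = Mid}, src = fst, tgt = snd,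
        ide = (\<lambda>x. (x, x)), cmp = (\<lambda>g f. (fst f, snd g))\<rparr>"

abbreviation is_pullback_functor where
  "is_pullback_functor \<equiv> is_limit_functor \<Lambda>"


section \<open>Size\<close>

text \<open>
  Smallness refers to a fixed universe, given by a strongly inaccessible cardinal \<open>U\<close> on some
  type \<open>'u\<close>: small means of cardinality less than \<open>U\<close>. Up to isomorphism every small category has
  its objects and arrows in \<open>'u\<close>, and every small cardinal is a well-order on a subset of \<open>'u\<close>, so
  quantification over small categories and cardinals is quantification over \<open>('u, 'u) cat\<close> and
  \<open>'u rel\<close>.
\<close>

definition regular_cardinal :: "'u rel \<Rightarrow> bool" where
  "regular_cardinal \<kappa> \<longleftrightarrow> Card_order \<kappa> \<and> infinite (Field \<kappa>) \<and> regularCard \<kappa>"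

definition inaccessible :: "'u rel \<Rightarrow> bool" where
  "inaccessible U \<longleftrightarrow> regular_cardinal U \<and> natLeq <o U
     \<and> (\<forall>A::'u set. |A| <o U \<longrightarrow> |Pow A| <o U)"

definition small_regular :: "'u rel \<Rightarrow> 'u rel \<Rightarrow> bool" where
  "small_regular U \<kappa> \<longleftrightarrow> regular_cardinal \<kappa> \<and> \<kappa> <o U"

text \<open>The objects of a category inject into its arrows, so bounding the arrows suffices.\<close>

definition small_cat :: "'u rel \<Rightarrow> ('j, 'i) cat \<Rightarrow> bool" where
  "small_cat r J \<longleftrightarrow> category J \<and> |Ar J| <o r"

definition locally_small :: "'u rel \<Rightarrow> ('o, 'a) cat \<Rightarrow> bool" where
  "locally_small U C \<longleftrightarrow> (\<forall>x\<in>Ob C. \<forall>y\<in>Ob C. |hom C x y| <o U)"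

definition complete_cat :: "'u rel \<Rightarrow> ('o, 'a) cat \<Rightarrow> bool" where
  "complete_cat U C \<longleftrightarrow> (\<forall>(J :: ('u, 'u) cat) D. small_cat U J \<and> is_functor J C D \<longrightarrow>
     (\<exists>c \<pi>. is_limit J C D c \<pi>))"

definition cocomplete_cat :: "'u rel \<Rightarrow> ('o, 'a) cat \<Rightarrow> bool" where
  "cocomplete_cat U C \<longleftrightarrow> (\<forall>(J :: ('u, 'u) cat) D. small_cat U J \<and> is_functor J C D \<longrightarrow>
     (\<exists>c \<gamma>. is_colimit J C D c \<gamma>))"

definition bicomplete :: "'u rel \<Rightarrow> ('o, 'a) cat \<Rightarrow> bool" where
  "bicomplete U C \<longleftrightarrow> complete_cat U C \<and> cocomplete_cat U C"


section \<open>Filtered colimits, accessibility and compactness\<close>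

definition filtered_cat :: "'u rel \<Rightarrow> ('j, 'i) cat \<Rightarrow> bool" where
  "filtered_cat \<kappa> J \<longleftrightarrow> category J \<and>
     (\<forall>(A :: ('u, 'u) cat) D. small_cat \<kappa> A \<and> is_functor A J D \<longrightarrow> (\<exists>j \<gamma>. is_cocone A J D j \<gamma>))"

definition preserves_filtered_colimits :: "'u rel \<Rightarrow> 'u rel \<Rightarrow> ('o, 'a) cat \<Rightarrow> ('p, 'b) cat
    \<Rightarrow> ('o, 'a, 'p, 'b) cfunctor \<Rightarrow> bool" where
  "preserves_filtered_colimits U \<kappa> C D F \<longleftrightarrow>
     (\<forall>(J :: ('u, 'u) cat) G c \<gamma>. small_cat U J \<and> filtered_cat \<kappa> J \<and> is_functor J C G
        \<and> is_colimit J C G c \<gamma> \<longrightarrow>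
        is_colimit J D (fcomp J F G) (fob F c) (\<lambda>j. far F (\<gamma> j)))"

definition accessible_functor :: "'u rel \<Rightarrow> ('o, 'a) cat \<Rightarrow> ('p, 'b) cat
    \<Rightarrow> ('o, 'a, 'p, 'b) cfunctor \<Rightarrow> bool" where
  "accessible_functor U C D F \<longleftrightarrow> is_functor C D F \<and>
     (\<exists>\<kappa>. small_regular U \<kappa> \<and> preserves_filtered_colimits U \<kappa> C D F)"

definition Set_cat :: "('x set, 'x set \<times> ('x \<Rightarrow> 'x) \<times> 'x set) cat" where
  "Set_cat = \<lparr>Ob = UNIV, Ar = {(A, f, B). f \<in> A \<rightarrow>\<^sub>E B},
     src = (\<lambda>(A, f, B). A), tgt = (\<lambda>(A, f, B). B),
     ide = (\<lambda>A. (A, restrict (\<lambda>x. x) A, A)),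
     cmp = (\<lambda>(_, g, Z) (X, f, _). (X, restrict (\<lambda>x. g (f x)) X, Z))\<rparr>"

text \<open>
  The functor \<open>Hom(x, -)\<close>, with values in the category of all sets of elements of \<open>'a + 'u\<close>. The
  summand \<open>'u\<close> makes sure that this category contains every small set up to bijection,
  however few arrows \<open>C\<close> has; \<open>'a\<close> accommodates the hom-sets, which need not be small.
  The argument \<open>U\<close> only serves to fix the type \<open>'u\<close>.
\<close>

definition Hom_functor :: "'u rel \<Rightarrow> ('o, 'a) cat \<Rightarrow> 'o
    \<Rightarrow> ('o, 'a, ('a + 'u) set, ('a + 'u) set \<times> ('a + 'u \<Rightarrow> 'a + 'u) \<times> ('a + 'u) set) cfunctor"
  where
  "Hom_functor U C x = \<lparr>fob = restrict (\<lambda>y. Inl ` hom C x y) (Ob C),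
     far = restrict (\<lambda>f. (Inl ` hom C x (src C f),
                         restrict (\<lambda>h. Inl (f \<cdot>\<^bsub>C\<^esub> projl h)) (Inl ` hom C x (src C f)),
                         Inl ` hom C x (tgt C f))) (Ar C)\<rparr>"

definition compact_object :: "'u rel \<Rightarrow> 'u rel \<Rightarrow> ('o, 'a) cat \<Rightarrow> 'o \<Rightarrow> bool" where
  "compact_object U \<kappa> C x \<longleftrightarrow> x \<in> Ob C
     \<and> preserves_filtered_colimits U \<kappa> C Set_cat (Hom_functor U C x)"

definition cocompact_object :: "'u rel \<Rightarrow> 'u rel \<Rightarrow> ('o, 'a) cat \<Rightarrow> 'o \<Rightarrow> bool" where
  "cocompact_object U \<kappa> C y \<longleftrightarrow> compact_object U \<kappa> (opcat C) y"

definition presentable :: "'u rel \<Rightarrow> ('o, 'a) cat \<Rightarrow> bool" where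
  "presentable U C \<longleftrightarrow> category C \<and> locally_small U C \<and> cocomplete_cat U C \<and>
     (\<exists>\<kappa> S. small_regular U \<kappa> \<and> |S| <o U \<and> (\<forall>s\<in>S. compact_object U \<kappa> C s) \<and>
        (\<forall>x\<in>Ob C. \<exists>(J :: ('u, 'u) cat) D \<gamma>. small_cat U J \<and> filtered_cat \<kappa> J \<and> is_functor J C D
           \<and> fob D ` Ob J \<subseteq> S \<and> is_colimit J C D x \<gamma>))"

definition subterminal :: "('o, 'a) cat \<Rightarrow> 'o \<Rightarrow> bool" where
  "subterminal C y \<longleftrightarrow> y \<in> Ob C \<and> (\<forall>x\<in>Ob C. \<forall>f\<in>hom C x y. \<forall>g\<in>hom C x y. f = g)"


section \<open>Well-formedness\<close>

lemma category_cospan: "category \<Lambda>"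
  by unfold_locales (auto simp: cospan_cat_def hom_def)

lemma category_opcat: "category C \<Longrightarrow> category (opcat C)"
  unfolding category_def by (simp add: opcat_def hom_def)

lemma category_Set: "category Set_cat"
  by unfold_locales
    (auto simp: Set_cat_def hom_def PiE_iff extensional_def fun_eq_iff restrict_def)

lemma is_functor_Hom:
  fixes C :: "('o, 'a) cat" and U :: "'b rel"
  assumes "category C" "x \<in> Ob C"
  shows "is_functor C Set_cat (Hom_functor U C x)"
proof -
  interpret category C by fact
  have post: "f \<cdot>\<^bsub>C\<^esub> h \<in> hom C x (tgt C f)" if "f \<in> Ar C" "h \<in> hom C x (src C f)" for f h
    using that cmp_hom[of h x "src C f" f "tgt C f"] by (simp add: hom_def)
  have arr: "g \<cdot>\<^bsub>C\<^esub> f \<in> Ar C" "src C (g \<cdot>\<^bsub>C\<^esub> f) = src C f" "tgt C (g \<cdot>\<^bsub>C\<^esub> f) = tgt C g"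
    if "f \<in> Ar C" "g \<in> Ar C" "src C g = tgt C f" for f g
    using that cmp_hom[of f "src C f" "tgt C f" g "tgt C g"] by (auto simp: hom_def)
  have assoc: "(g \<cdot>\<^bsub>C\<^esub> f) \<cdot>\<^bsub>C\<^esub> h = g \<cdot>\<^bsub>C\<^esub> (f \<cdot>\<^bsub>C\<^esub> h)"
    if "f \<in> Ar C" "g \<in> Ar C" "src C g = tgt C f" "h \<in> hom C x (src C f)" for f g h
    using that cmp_assoc[of h x "src C f" f "tgt C f" g "tgt C g"] by (simp add: hom_def)
  have ide: "ide C y \<in> Ar C" "src C (ide C y) = y" "tgt C (ide C y) = y" if "y \<in> Ob C" for y
    using ide_hom[OF that] by (auto simp: hom_def)
  have hom_Set: "hom Set_cat A B = {(A, h, B) |h. h \<in> A \<rightarrow>\<^sub>E B}" for A B :: "('a + 'b) set"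
    by (auto simp: hom_def Set_cat_def)
  show ?thesis
    unfolding is_functor_def
  proof (intro conjI ballI impI)
    fix f assume "f \<in> Ar C"
    then show "far (Hom_functor U C x) f
      \<in> hom Set_cat (fob (Hom_functor U C x) (src C f)) (fob (Hom_functor U C x) (tgt C f))"
      using post by (auto simp: Hom_functor_def hom_Set src_Ob tgt_Ob)
  next
    fix y assume "y \<in> Ob C"
    then show "far (Hom_functor U C x) (ide C y) = ide Set_cat (fob (Hom_functor U C x) y)"
      by (auto simp: Hom_functor_def Set_cat_def ide ide_cmp intro!: restrict_ext)
  next
    fix f g assume fg: "f \<in> Ar C" "g \<in> Ar C" "src C g = tgt C f"
    then show "far (Hom_functor U C x) (g \<cdot>\<^bsub>C\<^esub> f)
      = far (Hom_functor U C x) g \<cdot>\<^bsub>Set_cat\<^esub> far (Hom_functor U C x) f"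
      by (auto simp: Hom_functor_def Set_cat_def arr assoc post intro!: restrict_ext)
  qed (auto simp: assms category_Set, auto simp: Hom_functor_def Set_cat_def)
qed

lemma category_Fun:
  assumes "category J" "category C"
  shows "category (Fun J C)"
proof -
  interpret C: category C by fact
  interpret J: category J by fact
  note a = C.cmp_hom[unfolded hom_def, simplified] C.ide_hom[unfolded hom_def, simplified]
    C.ide_cmp[unfolded hom_def, simplified] C.cmp_ide[unfolded hom_def, simplified]
    C.cmp_assoc[unfolded hom_def, simplified] C.src_Ob C.tgt_Ob J.src_Ob J.tgt_Ob
  show ?thesis
  proof
    fix f F G g H assume "f \<in> hom (Fun J C) F G" "g \<in> hom (Fun J C) G H"
    then have f: "is_nattrans J C f" "nsrc f = F" "ntgt f = G"
      and g: "is_nattrans J C g" "nsrc g = G" "ntgt g = H"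
      by (auto simp: hom_def Fun_def)
    have "(ncomp g (tgt J u) \<cdot>\<^bsub>C\<^esub> ncomp f (tgt J u)) \<cdot>\<^bsub>C\<^esub> far F u
      = far H u \<cdot>\<^bsub>C\<^esub> (ncomp g (src J u) \<cdot>\<^bsub>C\<^esub> ncomp f (src J u))" if u: "u \<in> Ar J" for u
    proof -
      let ?s = "src J u" and ?t = "tgt J u"
      have st: "?s \<in> Ob J" "?t \<in> Ob J" using u J.src_Ob J.tgt_Ob by auto
      have F: "far F u \<in> hom C (fob F ?s) (fob F ?t)" and G: "far G u \<in> hom C (fob G ?s) (fob G ?t)"
        and H: "far H u \<in> hom C (fob H ?s) (fob H ?t)"
        using f g u by (auto simp: is_nattrans_def is_functor_def)
      have fs: "ncomp f ?s \<in> hom C (fob F ?s) (fob G ?s)" and ft: "ncomp f ?t \<in> hom C (fob F ?t) (fob G ?t)"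
        and gs: "ncomp g ?s \<in> hom C (fob G ?s) (fob H ?s)" and gt: "ncomp g ?t \<in> hom C (fob G ?t) (fob H ?t)"
        using f g st by (auto simp: is_nattrans_def)
      have nf: "ncomp f ?t \<cdot>\<^bsub>C\<^esub> far F u = far G u \<cdot>\<^bsub>C\<^esub> ncomp f ?s"
        and ng: "ncomp g ?t \<cdot>\<^bsub>C\<^esub> far G u = far H u \<cdot>\<^bsub>C\<^esub> ncomp g ?s"
        using f g u by (auto simp: is_nattrans_def)
      show ?thesis
        using C.cmp_assoc[OF F ft gt] C.cmp_assoc[OF fs G gt] C.cmp_assoc[OF fs gs H] nf ng by simp
    qed
    moreover have "ncomp g j \<cdot>\<^bsub>C\<^esub> ncomp f j \<in> hom C (fob F j) (fob H j)" if "j \<in> Ob J" for j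
      using f g that C.cmp_hom by (fastforce simp: is_nattrans_def)
    ultimately show "g \<cdot>\<^bsub>Fun J C\<^esub> f \<in> hom (Fun J C) F H"
      using f g by (auto simp: hom_def Fun_def is_nattrans_def J.src_Ob J.tgt_Ob)
  next
    fix x assume "x \<in> Ob (Fun J C)"
    then show "ide (Fun J C) x \<in> hom (Fun J C) x x"
      by (auto simp: hom_def Fun_def is_nattrans_def is_functor_def a)
  next
    fix f F G assume "f \<in> hom (Fun J C) F G"
    then show "ide (Fun J C) G \<cdot>\<^bsub>Fun J C\<^esub> f = f" "f \<cdot>\<^bsub>Fun J C\<^esub> ide (Fun J C) F = f"
      by (auto simp: hom_def Fun_def is_nattrans_def is_functor_def a restrict_def extensional_def
          fun_eq_iff intro!: nattrans.equality)
  next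
    fix f F G g H h K
    assume "f \<in> hom (Fun J C) F G" "g \<in> hom (Fun J C) G H" "h \<in> hom (Fun J C) H K"
    then show "h \<cdot>\<^bsub>Fun J C\<^esub> (g \<cdot>\<^bsub>Fun J C\<^esub> f) = (h \<cdot>\<^bsub>Fun J C\<^esub> g) \<cdot>\<^bsub>Fun J C\<^esub> f"
      by (auto simp: hom_def Fun_def is_nattrans_def is_functor_def a fun_eq_iff restrict_def)
  qed (auto simp: Fun_def is_nattrans_def)
qed

end

(*
  If C is presentable, a map from a compact object s to the pullback of a filtered colimit of cospans
  is a compatible pair of maps to the legs, so it factors through a stage, and two such maps become
  equal at a later stage. As every object is a filtered colimit of compact ones, this makes the
  pullback of the colimit the colimit of the pullbacks.

  Conversely, let pullbacks commute with mu-filtered colimits, let Y be mu-cocompact and f, g : X -> Y.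
  Write Q(A) for the coproduct of copies of X indexed by a subset A of mu, and let L be the limit of the
  Q([a, mu)) over a < mu. As Q(mu) is the colimit of the Q([0, b)), L is the colimit of the pullbacks of
  L -> Q(mu) <- Q([0, b)). On each of these the two maps L -> Q(mu) -> Y given by f and by g on all
  summands agree, as both equal the map given by f on the summands below b and by g on the others. So
  they agree on L. By cocompactness, they already agree on some Q([a, mu)), whence f = g.
*)
theory Submission
  imports Defs
begin

section \<open>Categories, cones and cocones\<close>

text \<open>In sets \<open>L\<close> is empty, because no summand lies in every tail, and
  cocompactness then identifies f and g at once. In a general \<open>C\<close> the maps between
  copowers need not be monic and \<open>L\<close> cannot be computed. Only one consequence of
  emptiness is required, that \<open>L\<close> cannot tell f from g, and accessibility of pullbacks
  replaces the computation: it presents \<open>L\<close>, which is its own pullback along the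
  identity of Q(mu), as glued from its parts over the Q([0, b)). The index order is taken to be the
  larger of the two given cardinals; by regularity it is filtered for both of them. An infinite
  cardinal has no last element, so the half-open segments [0, b) exhaust it.

  The obstacle in the presentable half is that the given colimits live in the category of cospans,
  whereas compactness speaks of colimits in \<open>C\<close>. Evaluation at a vertex has a right
  adjoint, built from constant cospans and the terminal object, so it preserves every colimit that
  exists, and colimits of cospans never have to be constructed pointwise.\<close>

lemma hom_iff: "f \<in> hom C x y \<longleftrightarrow> f \<in> Ar C \<and> src C f = x \<and> tgt C f = y"
  by (simp add: hom_def)

lemma (in category) hom_src_Ob: "f \<in> hom C x y \<Longrightarrow> x \<in> Ob C"
  and hom_tgt_Ob: "f \<in> hom C x y \<Longrightarrow> y \<in> Ob C"
  using src_Ob tgt_Ob by (auto simp: hom_def)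

lemma is_functorD:
  assumes "is_functor C D F"
  shows "category C" "category D"
    and "x \<in> Ob C \<Longrightarrow> fob F x \<in> Ob D"
    and "f \<in> hom C x y \<Longrightarrow> far F f \<in> hom D (fob F x) (fob F y)"
    and "x \<in> Ob C \<Longrightarrow> far F (ide C x) = ide D (fob F x)"
    and "f \<in> hom C x y \<Longrightarrow> g \<in> hom C y z \<Longrightarrow> far F (g \<cdot>\<^bsub>C\<^esub> f) = far F g \<cdot>\<^bsub>D\<^esub> far F f"
  using assms by (auto simp: is_functor_def hom_def)

lemma is_functorI:
  assumes "category C" "category D" "fob F \<in> extensional (Ob C)" "far F \<in> extensional (Ar C)"
    and "\<And>x. x \<in> Ob C \<Longrightarrow> fob F x \<in> Ob D"
    and "\<And>f x y. f \<in> hom C x y \<Longrightarrow> far F f \<in> hom D (fob F x) (fob F y)"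
    and "\<And>x. x \<in> Ob C \<Longrightarrow> far F (ide C x) = ide D (fob F x)"
    and "\<And>f g x y z. f \<in> hom C x y \<Longrightarrow> g \<in> hom C y z \<Longrightarrow>
      far F (g \<cdot>\<^bsub>C\<^esub> f) = far F g \<cdot>\<^bsub>D\<^esub> far F f"
  shows "is_functor C D F"
  using assms unfolding is_functor_def hom_iff by auto

lemma fcomp_simps:
  shows "x \<in> Ob C \<Longrightarrow> fob (fcomp C G F) x = fob G (fob F x)"
    and "f \<in> Ar C \<Longrightarrow> far (fcomp C G F) f = far G (far F f)"
    and "f \<in> hom C x y \<Longrightarrow> far (fcomp C G F) f = far G (far F f)"
  by (auto simp: fcomp_def hom_def)

lemma is_functor_fcomp:
  assumes F: "is_functor C D F" and G: "is_functor D E G"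
  shows "is_functor C E (fcomp C G F)"
proof -
  interpret category C using is_functorD(1)[OF F] .
  show ?thesis
  proof (rule is_functorI)
    show "category C" "category E" using is_functorD F G by blast+
    show "fob (fcomp C G F) \<in> extensional (Ob C)" "far (fcomp C G F) \<in> extensional (Ar C)"
      by (auto simp: fcomp_def)
  next
    fix x assume x: "x \<in> Ob C"
    then show "fob (fcomp C G F) x \<in> Ob E"
      by (simp add: fcomp_simps is_functorD(3)[OF F] is_functorD(3)[OF G])
    show "far (fcomp C G F) (ide C x) = ide E (fob (fcomp C G F) x)"
      using x by (simp add: fcomp_simps fcomp_simps(3)[OF ide_hom] is_functorD(3,5)[OF F]
          is_functorD(5)[OF G])
  next
    fix f x y assume f: "f \<in> hom C x y"
    show "far (fcomp C G F) f \<in> hom E (fob (fcomp C G F) x) (fob (fcomp C G F) y)"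
      using is_functorD(4)[OF G is_functorD(4)[OF F f]] f
      by (simp add: fcomp_simps hom_src_Ob[OF f] hom_tgt_Ob[OF f])
    fix g z assume g: "g \<in> hom C y z"
    show "far (fcomp C G F) (g \<cdot>\<^bsub>C\<^esub> f) = far (fcomp C G F) g \<cdot>\<^bsub>E\<^esub> far (fcomp C G F) f"
      using is_functorD(6)[OF F f g]
        is_functorD(6)[OF G is_functorD(4)[OF F f] is_functorD(4)[OF F g]]
      by (simp add: fcomp_simps(3)[OF cmp_hom[OF f g]] fcomp_simps(3)[OF f] fcomp_simps(3)[OF g])
  qed
qed

lemma is_coconeD:
  assumes "is_cocone J C D c \<gamma>"
  shows "c \<in> Ob C"
    and "j \<in> Ob J \<Longrightarrow> \<gamma> j \<in> hom C (fob D j) c"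
    and "u \<in> hom J i j \<Longrightarrow> \<gamma> j \<cdot>\<^bsub>C\<^esub> far D u = \<gamma> i"
  using assms by (auto simp: is_cocone_def hom_def)

lemma is_coconeI:
  assumes "c \<in> Ob C" "\<And>j. j \<in> Ob J \<Longrightarrow> \<gamma> j \<in> hom C (fob D j) c"
    and "\<And>u i j. u \<in> hom J i j \<Longrightarrow> \<gamma> j \<cdot>\<^bsub>C\<^esub> far D u = \<gamma> i"
  shows "is_cocone J C D c \<gamma>"
  using assms by (auto simp: is_cocone_def hom_def)

lemma is_coneD:
  assumes "is_cone J C D c \<pi>"
  shows "c \<in> Ob C"
    and "j \<in> Ob J \<Longrightarrow> \<pi> j \<in> hom C c (fob D j)"
    and "u \<in> hom J i j \<Longrightarrow> far D u \<cdot>\<^bsub>C\<^esub> \<pi> i = \<pi> j"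
  using assms by (auto simp: is_cone_def hom_def)

lemma is_coneI:
  assumes "c \<in> Ob C" "\<And>j. j \<in> Ob J \<Longrightarrow> \<pi> j \<in> hom C c (fob D j)"
    and "\<And>u i j. u \<in> hom J i j \<Longrightarrow> far D u \<cdot>\<^bsub>C\<^esub> \<pi> i = \<pi> j"
  shows "is_cone J C D c \<pi>"
  using assms by (auto simp: is_cone_def hom_def)

lemma cocone_cmp:
  assumes "is_functor J C D" "is_cocone J C D c \<gamma>" "h \<in> hom C c d"
  shows "is_cocone J C D d (\<lambda>j. h \<cdot>\<^bsub>C\<^esub> \<gamma> j)"
proof -
  interpret J: category J using assms is_functorD by blast
  interpret C: category C using assms is_functorD by blast
  show ?thesis
  proof (rule is_coconeI)
    fix u i j assume u: "u \<in> hom J i j"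
    show "(h \<cdot>\<^bsub>C\<^esub> \<gamma> j) \<cdot>\<^bsub>C\<^esub> far D u = h \<cdot>\<^bsub>C\<^esub> \<gamma> i"
      using C.cmp_assoc[OF is_functorD(4)[OF assms(1) u]
          is_coconeD(2)[OF assms(2) J.hom_tgt_Ob[OF u]] assms(3)] is_coconeD(3)[OF assms(2) u]
      by simp
  qed (use assms(3) C.hom_tgt_Ob C.cmp_hom is_coconeD(2)[OF assms(2)] in blast)+
qed

lemma cone_cmp:
  assumes "is_functor J C D" "is_cone J C D c \<pi>" "h \<in> hom C d c"
  shows "is_cone J C D d (\<lambda>j. \<pi> j \<cdot>\<^bsub>C\<^esub> h)"
proof -
  interpret J: category J using assms is_functorD by blast
  interpret C: category C using assms is_functorD by blast
  show ?thesis
  proof (rule is_coneI)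
    fix u i j assume u: "u \<in> hom J i j"
    show "far D u \<cdot>\<^bsub>C\<^esub> (\<pi> i \<cdot>\<^bsub>C\<^esub> h) = \<pi> j \<cdot>\<^bsub>C\<^esub> h"
      using C.cmp_assoc[OF assms(3) is_coneD(2)[OF assms(2) J.hom_src_Ob[OF u]]
          is_functorD(4)[OF assms(1) u]] is_coneD(3)[OF assms(2) u]
      by simp
  qed (use assms(3) C.hom_src_Ob C.cmp_hom is_coneD(2)[OF assms(2)] in blast)+
qed

lemma is_colimitI:
  assumes "is_cocone J C D c \<gamma>"
    and "\<And>d \<delta>. is_cocone J C D d \<delta> \<Longrightarrow> \<exists>h\<in>hom C c d. \<forall>j\<in>Ob J. h \<cdot>\<^bsub>C\<^esub> \<gamma> j = \<delta> j"
    and "\<And>d h h'. h \<in> hom C c d \<Longrightarrow> h' \<in> hom C c d \<Longrightarrow>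
      \<forall>j\<in>Ob J. h \<cdot>\<^bsub>C\<^esub> \<gamma> j = h' \<cdot>\<^bsub>C\<^esub> \<gamma> j \<Longrightarrow> h = h'"
  shows "is_colimit J C D c \<gamma>"
  unfolding is_colimit_def
proof (intro conjI allI impI)
  fix d \<delta> assume "is_cocone J C D d \<delta>"
  then obtain h where "h \<in> hom C c d" "\<forall>j\<in>Ob J. h \<cdot>\<^bsub>C\<^esub> \<gamma> j = \<delta> j" using assms(2) by blast
  then show "\<exists>!h. h \<in> hom C c d \<and> (\<forall>j\<in>Ob J. h \<cdot>\<^bsub>C\<^esub> \<gamma> j = \<delta> j)"
    by (intro ex1I[of _ h]) (auto intro: assms(3))
qed (fact assms(1))

lemma colimit_cocone: "is_colimit J C D c \<gamma> \<Longrightarrow> is_cocone J C D c \<gamma>"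
  by (simp add: is_colimit_def)

lemma limit_cone: "is_limit J C D c \<pi> \<Longrightarrow> is_cone J C D c \<pi>"
  by (simp add: is_limit_def)

lemma colimit_factor:
  assumes "is_colimit J C D c \<gamma>" "is_cocone J C D d \<delta>"
  obtains h where "h \<in> hom C c d" "\<And>j. j \<in> Ob J \<Longrightarrow> h \<cdot>\<^bsub>C\<^esub> \<gamma> j = \<delta> j"
  using assms unfolding is_colimit_def by blast

lemma limit_factor:
  assumes "is_limit J C D c \<pi>" "is_cone J C D d \<rho>"
  obtains h where "h \<in> hom C d c" "\<And>j. j \<in> Ob J \<Longrightarrow> \<pi> j \<cdot>\<^bsub>C\<^esub> h = \<rho> j"
  using assms unfolding is_limit_def by blast

lemma colimit_eqI:
  assumes "is_functor J C D" "is_colimit J C D c \<gamma>" "h \<in> hom C c d" "h' \<in> hom C c d"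
    and "\<And>j. j \<in> Ob J \<Longrightarrow> h \<cdot>\<^bsub>C\<^esub> \<gamma> j = h' \<cdot>\<^bsub>C\<^esub> \<gamma> j"
  shows "h = h'"
proof -
  have "is_cocone J C D d (\<lambda>j. h' \<cdot>\<^bsub>C\<^esub> \<gamma> j)"
    by (rule cocone_cmp[OF assms(1) colimit_cocone[OF assms(2)] assms(4)])
  then show ?thesis using assms unfolding is_colimit_def by blast
qed

lemma limit_eqI:
  assumes "is_functor J C D" "is_limit J C D c \<pi>" "h \<in> hom C d c" "h' \<in> hom C d c"
    and "\<And>j. j \<in> Ob J \<Longrightarrow> \<pi> j \<cdot>\<^bsub>C\<^esub> h = \<pi> j \<cdot>\<^bsub>C\<^esub> h'"
  shows "h = h'"
proof -
  have "is_cone J C D d (\<lambda>j. \<pi> j \<cdot>\<^bsub>C\<^esub> h')"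
    by (rule cone_cmp[OF assms(1) limit_cone[OF assms(2)] assms(4)])
  then show ?thesis using assms unfolding is_limit_def by blast
qed

section \<open>Filtered categories\<close>

lemma finite_card_less:
  assumes "regular_cardinal \<kappa>" "finite A"
  shows "|A| <o \<kappa>"
proof (rule finite_ordLess_infinite)
  show "Well_order |A|" "Well_order \<kappa>"
    using assms by (auto simp: regular_cardinal_def card_of_Well_order
        dest: card_order_on_well_order_on)
qed (use assms in \<open>auto simp: regular_cardinal_def Field_card_of\<close>)

lemma infinite_UNIV_regular: "regular_cardinal (\<kappa> :: 'u rel) \<Longrightarrow> infinite (UNIV :: 'u set)"
  unfolding regular_cardinal_def by (meson finite_subset subset_UNIV)

lemma filtered_cocone:
  fixes A :: "('u, 'u) cat" and \<kappa> :: "'u rel"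
  assumes "filtered_cat \<kappa> J" "small_cat \<kappa> A" "is_functor A J D"
  obtains j \<gamma> where "is_cocone A J D j \<gamma>"
  using assms unfolding filtered_cat_def by metis

text \<open>Objects double as their own identities, so that the category has the type
  \<open>('u, 'u) cat\<close> over which the definitions of filteredness and (co)completeness
  quantify. It serves for upper bounds of two objects, for the terminal object (\<open>A\<close>
  empty) and for copowers.\<close>

definition discrete_cat :: "'u set \<Rightarrow> ('u, 'u) cat" where
  "discrete_cat A = \<lparr>Ob = A, Ar = A, src = (\<lambda>x. x), tgt = (\<lambda>x. x), ide = (\<lambda>x. x),
     cmp = (\<lambda>g f. f)\<rparr>"

lemma category_discrete: "category (discrete_cat A)"
  by unfold_locales (auto simp: discrete_cat_def hom_def)

lemma discrete_cat_simps [simp]: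
  "Ob (discrete_cat A) = A" "Ar (discrete_cat A) = A" "ide (discrete_cat A) x = x"
  "src (discrete_cat A) x = x" "tgt (discrete_cat A) x = x" "g \<cdot>\<^bsub>discrete_cat A\<^esub> f = f"
  "f \<in> hom (discrete_cat A) x y \<longleftrightarrow> f \<in> A \<and> f = x \<and> f = y"
  by (auto simp: discrete_cat_def hom_def)

definition discrete_functor :: "'u set \<Rightarrow> ('o, 'a) cat \<Rightarrow> ('u \<Rightarrow> 'o) \<Rightarrow> ('u, 'u, 'o, 'a) cfunctor"
  where "discrete_functor A C F = \<lparr>fob = restrict F A, far = restrict (\<lambda>x. ide C (F x)) A\<rparr>"

lemma is_functor_discrete:
  assumes "category C" "\<And>x. x \<in> A \<Longrightarrow> F x \<in> Ob C"
  shows "is_functor (discrete_cat A) C (discrete_functor A C F)"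
proof -
  interpret category C by fact
  show ?thesis
    by (rule is_functorI)
      (auto simp: discrete_functor_def assms ide_hom ide_cmp[OF ide_hom] category_discrete)
qed

lemma discrete_cocone_iff:
  assumes "category C" "\<And>x. x \<in> A \<Longrightarrow> F x \<in> Ob C"
  shows "is_cocone (discrete_cat A) C (discrete_functor A C F) c \<gamma> \<longleftrightarrow>
    c \<in> Ob C \<and> (\<forall>x\<in>A. \<gamma> x \<in> hom C (F x) c)"
proof -
  interpret category C by fact
  show ?thesis
    by (auto simp: is_cocone_def discrete_functor_def assms cmp_ide)
qed

text \<open>A diagram on two discrete points has fewer than \<kappa> arrows since \<kappa> is
  infinite; a cocone on it is an upper bound. The two labels exist because \<open>'u\<close> is
  infinite.\<close>

lemma filtered_upper:
  fixes \<kappa> :: "'u rel"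
  assumes \<kappa>: "regular_cardinal \<kappa>" and J: "filtered_cat \<kappa> J" and ij: "i \<in> Ob J" "j \<in> Ob J"
  obtains k a b where "k \<in> Ob J" "a \<in> hom J i k" "b \<in> hom J j k"
proof -
  obtain B :: "'u set" where "card B = 2"
    using infinite_arbitrarily_large[OF infinite_UNIV_regular[OF \<kappa>]] by blast
  then obtain p q where pq: "B = {p, q}" "p \<noteq> q" by (auto simp: card_2_iff)
  let ?F = "\<lambda>x. if x = p then i else j"
  have cat: "category J" using J by (simp add: filtered_cat_def)
  have F: "\<And>x. x \<in> B \<Longrightarrow> ?F x \<in> Ob J" using ij by auto
  have "small_cat \<kappa> (discrete_cat B)"
    using finite_card_less[OF \<kappa>, of B] pq
    by (simp add: small_cat_def category_discrete)
  moreover have "is_functor (discrete_cat B) J (discrete_functor B J ?F)"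
    by (rule is_functor_discrete[OF cat F])
  ultimately obtain k \<gamma> where "is_cocone (discrete_cat B) J (discrete_functor B J ?F) k \<gamma>"
    by (rule filtered_cocone[OF J])
  then have "k \<in> Ob J" "\<forall>x\<in>B. \<gamma> x \<in> hom J (?F x) k"
    using discrete_cocone_iff[where A = B and F = ?F and C = J and c = k and \<gamma> = \<gamma>] cat ij
    by simp_all
  then have "k \<in> Ob J" "\<gamma> p \<in> hom J i k" "\<gamma> q \<in> hom J j k"
    using pq by auto
  then show thesis using that by blast
qed

text \<open>The shape of two parallel arrows \<open>u\<close>, \<open>v\<close> from
  \<open>p\<close> to \<open>q\<close>, where \<open>p\<close> and \<open>q\<close> also name the
  identities. Every composite involves an identity: if the first arrow is not \<open>p\<close>, the
  second can only be \<open>q\<close>, whence the formula for \<open>cmp\<close>.\<close>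

definition parallel_cat :: "'u \<Rightarrow> 'u \<Rightarrow> 'u \<Rightarrow> 'u \<Rightarrow> ('u, 'u) cat" where
  "parallel_cat p q u v = \<lparr>Ob = {p, q}, Ar = {p, q, u, v}, src = (\<lambda>x. if x = q then q else p),
     tgt = (\<lambda>x. if x = p then p else q), ide = (\<lambda>x. x),
     cmp = (\<lambda>g f. if f = p then g else f)\<rparr>"

lemma category_parallel: "distinct [p, q, u, v] \<Longrightarrow> category (parallel_cat p q u v)"
  by unfold_locales (auto simp: parallel_cat_def hom_def split: if_splits)

lemma filtered_coequalize:
  fixes \<kappa> :: "'u rel"
  assumes \<kappa>: "regular_cardinal \<kappa>" and J: "filtered_cat \<kappa> J" and a: "a \<in> hom J i k" and b: "b \<in> hom J i k"
  obtains m w where "w \<in> hom J k m" "w \<cdot>\<^bsub>J\<^esub> a = w \<cdot>\<^bsub>J\<^esub> b"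
proof -
  obtain B :: "'u set" where B: "card B = 4" "finite B"
    using infinite_arbitrarily_large[OF infinite_UNIV_regular[OF \<kappa>]] by blast
  then obtain xs where xs: "set xs = B" "distinct xs" "length xs = 4"
    using finite_distinct_list[OF B(2)] distinct_card by metis
  then obtain p q u v where "xs = [p, q, u, v]"
    by (auto simp: numeral_eq_Suc length_Suc_conv)
  then have pq: "distinct [p, q, u, v]" using xs by simp
  let ?P = "parallel_cat p q u v"
  let ?D = "\<lparr>fob = restrict (\<lambda>x. if x = p then i else k) {p, q},
    far = restrict (\<lambda>x. if x = p then ide J i else if x = q then ide J k
                        else if x = u then a else b) {p, q, u, v}\<rparr>"
  interpret category J using J by (simp add: filtered_cat_def)
  have ik: "i \<in> Ob J" "k \<in> Ob J" using a hom_src_Ob hom_tgt_Ob by auto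
  have D: "is_functor ?P J ?D"
    using pq ide_hom[OF ik(1)] ide_hom[OF ik(2)] ide_cmp[OF a] ide_cmp[OF b] cmp_ide[OF a] cmp_ide[OF b]
      ide_cmp[OF ide_hom[OF ik(1)]] ide_cmp[OF ide_hom[OF ik(2)]] a b ik
    by (intro is_functorI)
      (auto simp: category_parallel[unfolded parallel_cat_def] category_axioms parallel_cat_def
          hom_iff split: if_splits)
  have "small_cat \<kappa> ?P"
    using pq finite_card_less[OF \<kappa>, of "{p, q, u, v}"]
    by (simp add: small_cat_def category_parallel) (simp add: parallel_cat_def)
  then obtain m \<gamma> where "is_cocone ?P J ?D m \<gamma>"
    using filtered_cocone[OF J _ D] by blast
  then have "\<gamma> q \<in> hom J k m" "\<gamma> q \<cdot>\<^bsub>J\<^esub> a = \<gamma> p" "\<gamma> q \<cdot>\<^bsub>J\<^esub> b = \<gamma> p"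
    using pq by (auto simp: is_cocone_def parallel_cat_def)
  then show thesis using that by metis
qed

text \<open>An upper bound of \<open>j\<close> and \<open>k\<close> gives two arrows out of
  \<open>i\<close>, which a further arrow coequalizes.\<close>

lemma filtered_span:
  assumes \<kappa>: "regular_cardinal \<kappa>" and J: "filtered_cat \<kappa> J" and a: "a \<in> hom J i j" and b: "b \<in> hom J i k"
  obtains m v w where "v \<in> hom J j m" "w \<in> hom J k m" "v \<cdot>\<^bsub>J\<^esub> a = w \<cdot>\<^bsub>J\<^esub> b"
proof -
  interpret category J using J by (simp add: filtered_cat_def)
  obtain n v w where vw: "v \<in> hom J j n" "w \<in> hom J k n"
    using filtered_upper[OF \<kappa> J hom_tgt_Ob[OF a] hom_tgt_Ob[OF b]] by blast
  obtain m t where t: "t \<in> hom J n m" "t \<cdot>\<^bsub>J\<^esub> (v \<cdot>\<^bsub>J\<^esub> a) = t \<cdot>\<^bsub>J\<^esub> (w \<cdot>\<^bsub>J\<^esub> b)"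
    using filtered_coequalize[OF \<kappa> J cmp_hom[OF a vw(1)] cmp_hom[OF b vw(2)]] by blast
  show thesis
    using that[OF cmp_hom[OF vw(1) t(1)] cmp_hom[OF vw(2) t(1)]]
      t(2) cmp_assoc[OF a vw(1) t(1)] cmp_assoc[OF b vw(2) t(1)] by metis
qed

section \<open>Filtered colimits of sets and compact objects\<close>

definition app :: "'x set \<times> ('x \<Rightarrow> 'x) \<times> 'x set \<Rightarrow> 'x \<Rightarrow> 'x" where
  "app m = fst (snd m)"

lemma hom_Set_iff: "m \<in> hom Set_cat A B \<longleftrightarrow> m = (A, app m, B) \<and> app m \<in> A \<rightarrow>\<^sub>E B"
  by (cases m) (auto simp: hom_def Set_cat_def app_def)

lemma app_mem: "m \<in> hom Set_cat A B \<Longrightarrow> x \<in> A \<Longrightarrow> app m x \<in> B"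
  by (auto simp: hom_Set_iff)

lemma app_cmp:
  assumes "f \<in> hom Set_cat A B" "g \<in> hom Set_cat B D" "x \<in> A"
  shows "app (g \<cdot>\<^bsub>Set_cat\<^esub> f) x = app g (app f x)"
  using assms by (cases f; cases g) (auto simp: hom_def Set_cat_def app_def)

lemma hom_Set_eqI:
  assumes "f \<in> hom Set_cat A B" "g \<in> hom Set_cat A B" "\<And>x. x \<in> A \<Longrightarrow> app f x = app g x"
  shows "f = g"
proof -
  have "app f = app g" using assms PiE_ext unfolding hom_Set_iff by meson
  then show ?thesis using assms unfolding hom_Set_iff by metis
qed

lemma hom_SetI:
  assumes "\<And>x. x \<in> A \<Longrightarrow> t x \<in> B"
  shows "(A, restrict t A, B) \<in> hom Set_cat A B"
  using assms by (auto simp: hom_def Set_cat_def)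

lemma app_restrict: "x \<in> A \<Longrightarrow> app (A, restrict t A, B) x = t x"
  by (simp add: app_def)

text \<open>The indicator map of the union of the images of the legs and a constant map agree on
  every leg, hence everywhere. Two distinct elements of the carrier type are what the target of this
  test consists of.\<close>

lemma Set_colimit_jointly_surjective:
  assumes p: "p \<noteq> (q :: 'x)" and D: "is_functor J (Set_cat :: ('x set, _) cat) D"
    and col: "is_colimit J Set_cat D S \<gamma>" and x: "x \<in> S"
  obtains j y where "j \<in> Ob J" "y \<in> fob D j" "app (\<gamma> j) y = x"
proof (rule ccontr)
  assume neg: "\<not> thesis"
  let ?t = "\<lambda>z. if \<exists>j\<in>Ob J. \<exists>y\<in>fob D j. app (\<gamma> j) y = z then p else q"
  let ?h = "(S, restrict ?t S, {p, q})" and ?k = "(S, restrict (\<lambda>z. p) S, {p, q})"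
  have hk: "?h \<in> hom Set_cat S {p, q}" "?k \<in> hom Set_cat S {p, q}"
    by (intro hom_SetI; simp)+
  have "?h = ?k"
  proof (rule colimit_eqI[OF D col hk])
    fix j assume j: "j \<in> Ob J"
    note \<gamma> = is_coconeD(2)[OF colimit_cocone[OF col] j]
    show "?h \<cdot>\<^bsub>Set_cat\<^esub> \<gamma> j = ?k \<cdot>\<^bsub>Set_cat\<^esub> \<gamma> j"
    proof (rule hom_Set_eqI)
      show "?h \<cdot>\<^bsub>Set_cat\<^esub> \<gamma> j \<in> hom Set_cat (fob D j) {p, q}"
        "?k \<cdot>\<^bsub>Set_cat\<^esub> \<gamma> j \<in> hom Set_cat (fob D j) {p, q}"
        using category.cmp_hom[OF category_Set \<gamma>] hk by blast+
      fix y assume "y \<in> fob D j"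
      then show "app (?h \<cdot>\<^bsub>Set_cat\<^esub> \<gamma> j) y = app (?k \<cdot>\<^bsub>Set_cat\<^esub> \<gamma> j) y"
        using j app_mem[OF \<gamma>] by (auto simp: app_cmp[OF \<gamma> hk(1)] app_cmp[OF \<gamma> hk(2)] app_restrict)
    qed
  qed
  then have "app ?h x = app ?k x" by simp
  then have "?t x = p" using x by (simp add: app_restrict)
  then show False using p neg that by (metis (mono_tags, lifting))
qed

text \<open>
  Test with the cocone to a two-element set that sends \<open>h\<close> to \<open>p\<close> iff \<open>h\<close> and \<open>y\<close> become equal
  at some later stage.
\<close>

lemma Set_colimit_eq:
  fixes \<kappa> :: "'u rel"
  assumes p: "p \<noteq> (q :: 'x)" and \<kappa>: "regular_cardinal \<kappa>" and J: "filtered_cat \<kappa> J"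
    and D: "is_functor J (Set_cat :: ('x set, _) cat) D"
    and col: "is_colimit J Set_cat D S \<gamma>"
    and j: "j \<in> Ob J" and yz: "y \<in> fob D j" "z \<in> fob D j" "app (\<gamma> j) y = app (\<gamma> j) z"
  obtains k u where "u \<in> hom J j k" "app (far D u) y = app (far D u) z"
proof -
  interpret J: category J using J by (simp add: filtered_cat_def)
  define E where "E k h \<longleftrightarrow> (\<exists>m. \<exists>u\<in>hom J j m. \<exists>v\<in>hom J k m. app (far D u) y = app (far D v) h)" for k h
  let ?\<delta> = "\<lambda>k. (fob D k, restrict (\<lambda>h. if E k h then p else q) (fob D k), {p, q})"
  have \<delta>: "?\<delta> k \<in> hom Set_cat (fob D k) {p, q}" for k
    by (intro hom_SetI) simp
  have far_cmp: "app (far D (w \<cdot>\<^bsub>J\<^esub> v)) h = app (far D w) (app (far D v) h)"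
    if "v \<in> hom J a b" "w \<in> hom J b c" "h \<in> fob D a" for v w a b c h
    using is_functorD(6)[OF D that(1,2)]
      app_cmp[OF is_functorD(4)[OF D that(1)] is_functorD(4)[OF D that(2)] that(3)] by simp
  have E_far: "E k' (app (far D w) h) \<longleftrightarrow> E k h" if w: "w \<in> hom J k k'" and h: "h \<in> fob D k" for w k k' h
  proof
    assume "E k' (app (far D w) h)"
    then obtain m u v where "u \<in> hom J j m" "v \<in> hom J k' m"
      "app (far D u) y = app (far D v) (app (far D w) h)" unfolding E_def by blast
    then show "E k h"
      unfolding E_def using far_cmp[OF w _ h] J.cmp_hom[OF w] by metis
  next
    assume "E k h"
    then obtain m u v where uv: "u \<in> hom J j m" "v \<in> hom J k m" "app (far D u) y = app (far D v) h"
      unfolding E_def by blast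
    obtain n a b where ab: "a \<in> hom J m n" "b \<in> hom J k' n" "a \<cdot>\<^bsub>J\<^esub> v = b \<cdot>\<^bsub>J\<^esub> w"
      using filtered_span[OF \<kappa> J uv(2) w] by blast
    have "app (far D (a \<cdot>\<^bsub>J\<^esub> u)) y = app (far D b) (app (far D w) h)"
      using far_cmp[OF uv(1) ab(1) yz(1)] far_cmp[OF uv(2) ab(1) h] far_cmp[OF w ab(2) h] ab(3) uv(3)
      by simp
    then show "E k' (app (far D w) h)" unfolding E_def using J.cmp_hom[OF uv(1) ab(1)] ab(2) by blast
  qed
  have "is_cocone J Set_cat D {p, q} ?\<delta>"
  proof (rule is_coconeI)
    fix w k k' assume w: "w \<in> hom J k k'"
    note Dw = is_functorD(4)[OF D w]
    show "?\<delta> k' \<cdot>\<^bsub>Set_cat\<^esub> far D w = ?\<delta> k"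
    proof (rule hom_Set_eqI[OF category.cmp_hom[OF category_Set Dw \<delta>] \<delta>])
      fix h assume h: "h \<in> fob D k"
      show "app (?\<delta> k' \<cdot>\<^bsub>Set_cat\<^esub> far D w) h = app (?\<delta> k) h"
        by (simp only: app_cmp[OF Dw \<delta> h] app_restrict[OF h] app_restrict[OF app_mem[OF Dw h]] E_far[OF w h])
    qed
  qed (use \<delta> in \<open>simp_all add: Set_cat_def\<close>)
  then obtain t where t: "t \<in> hom Set_cat S {p, q}" "\<And>k. k \<in> Ob J \<Longrightarrow> t \<cdot>\<^bsub>Set_cat\<^esub> \<gamma> k = ?\<delta> k"
    using colimit_factor[OF col] by blast
  note \<gamma> = is_coconeD(2)[OF colimit_cocone[OF col] j]
  have "app (?\<delta> j) y = app (?\<delta> j) z"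
    unfolding t(2)[OF j, symmetric] app_cmp[OF \<gamma> t(1) yz(1)] app_cmp[OF \<gamma> t(1) yz(2)] yz(3) ..
  moreover have "E j y" unfolding E_def using J.ide_hom[OF j] by blast
  ultimately have "E j z" using p yz by (simp add: app_restrict split: if_splits)
  then obtain m u v where uv: "u \<in> hom J j m" "v \<in> hom J j m" "app (far D u) y = app (far D v) z"
    unfolding E_def by blast
  obtain n w where w: "w \<in> hom J m n" "w \<cdot>\<^bsub>J\<^esub> u = w \<cdot>\<^bsub>J\<^esub> v"
    using filtered_coequalize[OF \<kappa> J uv(1,2)] by blast
  have "app (far D (w \<cdot>\<^bsub>J\<^esub> u)) y = app (far D (w \<cdot>\<^bsub>J\<^esub> u)) z"
    using far_cmp[OF uv(1) w(1) yz(1)] far_cmp[OF uv(2) w(1) yz(2)] uv(3) w(2) by simp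
  then show thesis using that J.cmp_hom[OF uv(1) w(1)] by blast
qed

text \<open>The arrow type \<open>'a\<close> may have a single element; the summand
  \<open>'u\<close> supplies the two-point set used in the tests on colimits of sets.\<close>

lemma ex_distinct_sum:
  assumes "infinite (UNIV :: 'u set)"
  obtains p q :: "'a + 'u" where "p \<noteq> q"
proof -
  obtain x y :: 'u where "x \<noteq> y"
    using assms finite_subset[of UNIV "{undefined :: 'u}"] by auto
  then show thesis using that[of "Inr x" "Inr y"] by simp
qed

section \<open>Maps from a compact object into a filtered colimit\<close>

lemma fob_Hom: "y \<in> Ob C \<Longrightarrow> fob (Hom_functor U C s) y = Inl ` hom C s y"
  by (simp add: Hom_functor_def)

lemma compact_hom_colimit:
  fixes C :: "('o, 'a) cat" and J :: "('u, 'u) cat"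
  assumes cpt: "compact_object U \<kappa> C s" and J: "small_cat U J" "filtered_cat \<kappa> J"
    and G: "is_functor J C G" and col: "is_colimit J C G c \<gamma>"
  shows "is_functor J (Set_cat :: (('a + 'u) set, _) cat) (fcomp J (Hom_functor U C s) G)"
    and "is_colimit J Set_cat (fcomp J (Hom_functor U C s) G) (Inl ` hom C s c)
      (\<lambda>j. far (Hom_functor U C s) (\<gamma> j))"
proof -
  have C: "category C" using G is_functorD by blast
  have s: "s \<in> Ob C" using cpt by (simp add: compact_object_def)
  show "is_functor J (Set_cat :: (('a + 'u) set, _) cat) (fcomp J (Hom_functor U C s) G)"
    by (rule is_functor_fcomp[OF G is_functor_Hom[OF C s]])
  have "c \<in> Ob C" using is_coconeD(1)[OF colimit_cocone[OF col]] .
  moreover have "is_colimit J Set_cat (fcomp J (Hom_functor U C s) G) (fob (Hom_functor U C s) c)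
      (\<lambda>j. far (Hom_functor U C s) (\<gamma> j))"
    using cpt J G col unfolding compact_object_def preserves_filtered_colimits_def by blast
  ultimately show "is_colimit J Set_cat (fcomp J (Hom_functor U C s) G) (Inl ` hom C s c)
      (\<lambda>j. far (Hom_functor U C s) (\<gamma> j))"
    by (simp only: fob_Hom)
qed

lemma app_Hom: "f \<in> hom C x y \<Longrightarrow> h \<in> hom C s x \<Longrightarrow>
    app (far (Hom_functor U C s) f) (Inl h) = Inl (f \<cdot>\<^bsub>C\<^esub> h)"
  by (auto simp: Hom_functor_def hom_iff app_def)

text \<open>Collects the element-free form of compactness: existence and eventual uniqueness of
  lifts to a stage. It is instantiated for presentations by compact objects, for cospan diagrams
  evaluated at a vertex, and in \<open>opcat C\<close> for the tails of copowers.\<close>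

locale compact_test =
  fixes U \<kappa> :: "'u rel" and C :: "('o, 'a) cat" and J :: "('u, 'u) cat" and G c \<gamma> s
  assumes \<kappa>: "regular_cardinal \<kappa>" and cpt: "compact_object U \<kappa> C s"
    and J: "small_cat U J" "filtered_cat \<kappa> J"
    and G: "is_functor J C G" and col: "is_colimit J C G c \<gamma>"
begin

lemma factors_through_stage:
  assumes f: "f \<in> hom C s c"
  obtains j h where "j \<in> Ob J" "h \<in> hom C s (fob G j)" "\<gamma> j \<cdot>\<^bsub>C\<^esub> h = f"
proof -
  obtain p q :: "'a + 'u" where pq: "p \<noteq> q" using ex_distinct_sum[OF infinite_UNIV_regular[OF \<kappa>]] .
  obtain j y where j: "j \<in> Ob J" and y: "y \<in> fob (fcomp J (Hom_functor U C s) G) j"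
      "app (far (Hom_functor U C s) (\<gamma> j)) y = Inl f"
    using Set_colimit_jointly_surjective[OF pq compact_hom_colimit[OF cpt J G col], of "Inl f"] f
    by blast
  note \<gamma> = is_coconeD(2)[OF colimit_cocone[OF col] j]
  obtain h where h: "y = Inl h" "h \<in> hom C s (fob G j)"
    using y(1) j by (auto simp: fcomp_simps fob_Hom is_functorD(3)[OF G j])
  then show thesis using that[OF j h(2)] y(2) app_Hom[OF \<gamma> h(2), of U] by simp
qed

lemma equal_at_stage:
  assumes j: "j \<in> Ob J" and g: "g \<in> hom C s (fob G j)" and h: "h \<in> hom C s (fob G j)"
    and eq: "\<gamma> j \<cdot>\<^bsub>C\<^esub> g = \<gamma> j \<cdot>\<^bsub>C\<^esub> h"
  obtains k u where "u \<in> hom J j k" "far G u \<cdot>\<^bsub>C\<^esub> g = far G u \<cdot>\<^bsub>C\<^esub> h"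
proof -
  obtain p q :: "'a + 'u" where pq: "p \<noteq> q" using ex_distinct_sum[OF infinite_UNIV_regular[OF \<kappa>]] .
  note \<gamma> = is_coconeD(2)[OF colimit_cocone[OF col] j]
  have gh: "Inl g \<in> fob (fcomp J (Hom_functor U C s) G) j" "Inl h \<in> fob (fcomp J (Hom_functor U C s) G) j"
    using g h j by (auto simp: fcomp_simps fob_Hom is_functorD(3)[OF G j])
  have "app (far (Hom_functor U C s) (\<gamma> j)) (Inl g) = app (far (Hom_functor U C s) (\<gamma> j)) (Inl h)"
    by (simp add: app_Hom[OF \<gamma>] g h eq)
  then obtain k u where u: "u \<in> hom J j k" "app (far (fcomp J (Hom_functor U C s) G) u) (Inl g)
      = app (far (fcomp J (Hom_functor U C s) G) u) (Inl h)"
    using Set_colimit_eq[OF pq \<kappa> J(2) compact_hom_colimit[OF cpt J G col] j gh] by blast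
  then show thesis
    using that[OF u(1)] app_Hom[OF is_functorD(4)[OF G u(1)] g, of U]
      app_Hom[OF is_functorD(4)[OF G u(1)] h, of U]
    by (simp add: fcomp_simps(3)[OF u(1)])
qed

end

text \<open>
  Since a cocone \<open>\<delta>\<close> on \<open>K\<close> acts consistently on all maps from compact objects into \<open>P\<close>, a
  presentation of \<open>P\<close> by compact objects glues these actions to a morphism out of \<open>P\<close>.
\<close>

lemma colimit_by_compact_objects:
  fixes U \<kappa> :: "'u rel" and C :: "('o, 'a) cat" and J :: "('j, 'i) cat"
  assumes \<kappa>: "regular_cardinal \<kappa>" and S: "\<And>s. s \<in> S \<Longrightarrow> compact_object U \<kappa> C s"
    and pres: "\<And>x. x \<in> Ob C \<Longrightarrow> \<exists>(I :: ('u, 'u) cat) D \<gamma>. small_cat U I \<and> filtered_cat \<kappa> I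
      \<and> is_functor I C D \<and> fob D ` Ob I \<subseteq> S \<and> is_colimit I C D x \<gamma>"
    and J: "filtered_cat \<kappa> J" and K: "is_functor J C K" and \<theta>: "is_cocone J C K P \<theta>"
    and factor: "\<And>s f. s \<in> S \<Longrightarrow> f \<in> hom C s P \<Longrightarrow>
      \<exists>k\<in>Ob J. \<exists>g\<in>hom C s (fob K k). \<theta> k \<cdot>\<^bsub>C\<^esub> g = f"
    and eq: "\<And>s k g g'. s \<in> S \<Longrightarrow> k \<in> Ob J \<Longrightarrow> g \<in> hom C s (fob K k) \<Longrightarrow> g' \<in> hom C s (fob K k) \<Longrightarrow>
      \<theta> k \<cdot>\<^bsub>C\<^esub> g = \<theta> k \<cdot>\<^bsub>C\<^esub> g' \<Longrightarrow> \<exists>m. \<exists>u\<in>hom J k m. far K u \<cdot>\<^bsub>C\<^esub> g = far K u \<cdot>\<^bsub>C\<^esub> g'"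
  shows "is_colimit J C K P \<theta>"
proof (rule is_colimitI[OF \<theta>])
  interpret J: category J using is_functorD(1)[OF K] .
  interpret C: category C using is_functorD(2)[OF K] .
  note \<theta>_hom = is_coconeD(2)[OF \<theta>]
  obtain I :: "('u, 'u) cat" and D \<iota> where I: "small_cat U I" "filtered_cat \<kappa> I" "is_functor I C D"
      "fob D ` Ob I \<subseteq> S" "is_colimit I C D P \<iota>"
    using pres[OF is_coconeD(1)[OF \<theta>]] by blast
  have DS: "fob D i \<in> S" if "i \<in> Ob I" for i using I(4) that by blast
  note \<iota> = is_coconeD(2)[OF colimit_cocone[OF I(5)]]
  fix d
  {
    fix h h' assume h: "h \<in> hom C P d" "h' \<in> hom C P d" "\<forall>j\<in>Ob J. h \<cdot>\<^bsub>C\<^esub> \<theta> j = h' \<cdot>\<^bsub>C\<^esub> \<theta> j"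
    show "h = h'"
    proof (rule colimit_eqI[OF I(3,5) h(1,2)])
      fix i assume i: "i \<in> Ob I"
      obtain k g where k: "k \<in> Ob J" "g \<in> hom C (fob D i) (fob K k)" "\<theta> k \<cdot>\<^bsub>C\<^esub> g = \<iota> i"
        using factor[OF DS[OF i] \<iota>[OF i]] by blast
      show "h \<cdot>\<^bsub>C\<^esub> \<iota> i = h' \<cdot>\<^bsub>C\<^esub> \<iota> i"
        using C.cmp_assoc[OF k(2) \<theta>_hom[OF k(1)] h(1)] C.cmp_assoc[OF k(2) \<theta>_hom[OF k(1)] h(2)]
          h(3) k(1,3) by simp
    qed
  }
  fix \<delta> assume \<delta>: "is_cocone J C K d \<delta>"
  note \<delta>_hom = is_coconeD(2)[OF \<delta>]
  have push: "\<delta> n \<cdot>\<^bsub>C\<^esub> (far K u \<cdot>\<^bsub>C\<^esub> g) = \<delta> k \<cdot>\<^bsub>C\<^esub> g" "\<theta> n \<cdot>\<^bsub>C\<^esub> (far K u \<cdot>\<^bsub>C\<^esub> g) = \<theta> k \<cdot>\<^bsub>C\<^esub> g"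
    "far K u \<cdot>\<^bsub>C\<^esub> g \<in> hom C s (fob K n)"
    if u: "u \<in> hom J k n" and g: "g \<in> hom C s (fob K k)" for u k n s g
    using C.cmp_assoc[OF g is_functorD(4)[OF K u] \<delta>_hom[OF J.hom_tgt_Ob[OF u]]]
      C.cmp_assoc[OF g is_functorD(4)[OF K u] \<theta>_hom[OF J.hom_tgt_Ob[OF u]]]
      is_coconeD(3)[OF \<delta> u] is_coconeD(3)[OF \<theta> u] C.cmp_hom[OF g is_functorD(4)[OF K u]]
    by simp_all
  \<comment> \<open>Two lifts of the same map are moved to a common stage \<open>n\<close>. They
    agree after \<theta>, hence already at a later stage \<open>r\<close> by \<open>eq\<close>, and
    \<delta> is compatible with both moves.\<close>
  have wd: "\<delta> k \<cdot>\<^bsub>C\<^esub> g = \<delta> m \<cdot>\<^bsub>C\<^esub> g'"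
    if s: "s \<in> S" and k: "k \<in> Ob J" and g: "g \<in> hom C s (fob K k)" and m: "m \<in> Ob J"
      and g': "g' \<in> hom C s (fob K m)" and gg': "\<theta> k \<cdot>\<^bsub>C\<^esub> g = \<theta> m \<cdot>\<^bsub>C\<^esub> g'" for s k g m g'
  proof -
    obtain n a b where ab: "n \<in> Ob J" "a \<in> hom J k n" "b \<in> hom J m n"
      using filtered_upper[OF \<kappa> J k m] by blast
    obtain r u where u: "u \<in> hom J n r"
      "far K u \<cdot>\<^bsub>C\<^esub> (far K a \<cdot>\<^bsub>C\<^esub> g) = far K u \<cdot>\<^bsub>C\<^esub> (far K b \<cdot>\<^bsub>C\<^esub> g')"
      using eq[OF s ab(1) push(3)[OF ab(2) g] push(3)[OF ab(3) g']]
        push(2)[OF ab(2) g] push(2)[OF ab(3) g'] gg' by auto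
    then show ?thesis
      using push(1)[OF u(1) push(3)[OF ab(2) g]] push(1)[OF u(1) push(3)[OF ab(3) g']]
        push(1)[OF ab(2) g] push(1)[OF ab(3) g'] by simp
  qed
  \<comment> \<open>The action of \<delta> on a map \<open>f\<close> from an object of
    \<open>S\<close> into \<open>P\<close>: lift \<open>f\<close> to some stage and apply \<delta>
    there. By \<open>wd\<close> the lift picked by \<open>SOME\<close> does not matter.\<close>
  define \<Theta> where "\<Theta> f = (SOME t. \<exists>k\<in>Ob J. \<exists>g\<in>hom C (src C f) (fob K k). \<theta> k \<cdot>\<^bsub>C\<^esub> g = f \<and> t = \<delta> k \<cdot>\<^bsub>C\<^esub> g)" for f
  have \<Theta>: "\<Theta> f = \<delta> k \<cdot>\<^bsub>C\<^esub> g"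
    if s: "s \<in> S" and k: "k \<in> Ob J" and g: "g \<in> hom C s (fob K k)" and f: "\<theta> k \<cdot>\<^bsub>C\<^esub> g = f" for s k g f
  proof -
    have "src C f = s" using C.cmp_hom[OF g \<theta>_hom[OF k]] f by (simp add: hom_iff)
    then have "\<exists>t. \<exists>k\<in>Ob J. \<exists>g\<in>hom C s (fob K k). \<theta> k \<cdot>\<^bsub>C\<^esub> g = f \<and> t = \<delta> k \<cdot>\<^bsub>C\<^esub> g"
      and \<Theta>_def': "\<Theta> f = (SOME t. \<exists>k\<in>Ob J. \<exists>g\<in>hom C s (fob K k). \<theta> k \<cdot>\<^bsub>C\<^esub> g = f \<and> t = \<delta> k \<cdot>\<^bsub>C\<^esub> g)"
      using k g f unfolding \<Theta>_def by auto
    from someI_ex[OF this(1)] obtain m g' where "m \<in> Ob J" "g' \<in> hom C s (fob K m)" "\<theta> m \<cdot>\<^bsub>C\<^esub> g' = f"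
      "\<Theta> f = \<delta> m \<cdot>\<^bsub>C\<^esub> g'" unfolding \<Theta>_def' by blast
    then show ?thesis using wd[OF s k g, of m g'] f by simp
  qed
  have \<Theta>_cmp: "\<Theta> (f \<cdot>\<^bsub>C\<^esub> u) = \<Theta> f \<cdot>\<^bsub>C\<^esub> u" and \<Theta>_hom: "\<Theta> f \<in> hom C s d"
    if s: "s \<in> S" "r \<in> S" and f: "f \<in> hom C s P" and u: "u \<in> hom C r s" for f u r s
  proof -
    obtain k g where k: "k \<in> Ob J" "g \<in> hom C s (fob K k)" "\<theta> k \<cdot>\<^bsub>C\<^esub> g = f"
      using factor[OF s(1) f] by blast
    show "\<Theta> (f \<cdot>\<^bsub>C\<^esub> u) = \<Theta> f \<cdot>\<^bsub>C\<^esub> u"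
      using \<Theta>[OF s(1) k] \<Theta>[OF s(2) k(1) C.cmp_hom[OF u k(2)], of "f \<cdot>\<^bsub>C\<^esub> u"] k(3)
        C.cmp_assoc[OF u k(2) \<theta>_hom[OF k(1)]] C.cmp_assoc[OF u k(2) \<delta>_hom[OF k(1)]] by simp
    show "\<Theta> f \<in> hom C s d"
      using \<Theta>[OF s(1) k] C.cmp_hom[OF k(2) \<delta>_hom[OF k(1)]] by simp
  qed
  interpret I: category I using is_functorD(1)[OF I(3)] .
  have "is_cocone I C D d (\<lambda>i. \<Theta> (\<iota> i))"
  proof (rule is_coconeI)
    show "d \<in> Ob C" using is_coconeD(1)[OF \<delta>] .
    fix i assume i: "i \<in> Ob I"
    show "\<Theta> (\<iota> i) \<in> hom C (fob D i) d"
      using \<Theta>_hom[OF DS[OF i] DS[OF i] \<iota>[OF i] C.ide_hom] is_functorD(3)[OF I(3) i] by simp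
  next
    fix u i j assume u: "u \<in> hom I i j"
    show "\<Theta> (\<iota> j) \<cdot>\<^bsub>C\<^esub> far D u = \<Theta> (\<iota> i)"
      using \<Theta>_cmp[OF DS[OF I.hom_tgt_Ob[OF u]] DS[OF I.hom_src_Ob[OF u]] \<iota>[OF I.hom_tgt_Ob[OF u]]
          is_functorD(4)[OF I(3) u]] is_coconeD(3)[OF colimit_cocone[OF I(5)] u] by simp
  qed
  then obtain h where h: "h \<in> hom C P d" "\<And>i. i \<in> Ob I \<Longrightarrow> h \<cdot>\<^bsub>C\<^esub> \<iota> i = \<Theta> (\<iota> i)"
    using colimit_factor[OF I(5)] by blast
  \<comment> \<open>So far \<open>h\<close> is known only on the legs \<iota>. Any map from a
    compact object factors through such a leg, and \<Theta> is compatible with precomposition, which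
    extends the equation to all of them.\<close>
  have h\<Theta>: "h \<cdot>\<^bsub>C\<^esub> f = \<Theta> f" if s: "s \<in> S" and f: "f \<in> hom C s P" for s f
  proof -
    interpret compact_test U \<kappa> C I D P \<iota> s
      using \<kappa> S[OF s] I by unfold_locales
    obtain i v where v: "i \<in> Ob I" "v \<in> hom C s (fob D i)" "\<iota> i \<cdot>\<^bsub>C\<^esub> v = f"
      using factors_through_stage[OF f] by blast
    show ?thesis
      using C.cmp_assoc[OF v(2) \<iota>[OF v(1)] h(1)] h(2)[OF v(1)] \<Theta>_cmp[OF DS[OF v(1)] s \<iota>[OF v(1)] v(2)] v(3)
      by simp
  qed
  have "h \<cdot>\<^bsub>C\<^esub> \<theta> j = \<delta> j" if j: "j \<in> Ob J" for j
  proof -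
    \<comment> \<open>The object \<open>fob K j\<close> need not lie in \<open>S\<close>, so it is
      presented by compact objects as well; on these \<open>h\<Theta>\<close> applies, with the leg
      into \<open>fob K j\<close> as the chosen lift.\<close>
    obtain A :: "('u, 'u) cat" and B \<beta> where A: "small_cat U A" "filtered_cat \<kappa> A" "is_functor A C B"
      "fob B ` Ob A \<subseteq> S" "is_colimit A C B (fob K j) \<beta>"
      using pres[OF is_functorD(3)[OF K j]] by blast
    show ?thesis
    proof (rule colimit_eqI[OF A(3,5) C.cmp_hom[OF \<theta>_hom[OF j] h(1)] \<delta>_hom[OF j]])
      fix a assume a: "a \<in> Ob A"
      note \<beta> = is_coconeD(2)[OF colimit_cocone[OF A(5)] a]
      have aS: "fob B a \<in> S" using A(4) a by blast
      show "(h \<cdot>\<^bsub>C\<^esub> \<theta> j) \<cdot>\<^bsub>C\<^esub> \<beta> a = \<delta> j \<cdot>\<^bsub>C\<^esub> \<beta> a"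
        using C.cmp_assoc[OF \<beta> \<theta>_hom[OF j] h(1)] h\<Theta>[OF aS C.cmp_hom[OF \<beta> \<theta>_hom[OF j]]]
          \<Theta>[OF aS j \<beta> refl] by simp
    qed
  qed
  then show "\<exists>h\<in>hom C P d. \<forall>j\<in>Ob J. h \<cdot>\<^bsub>C\<^esub> \<theta> j = \<delta> j" using h(1) by blast
qed

section \<open>Functor categories and cospans\<close>

lemma Ob_Fun: "F \<in> Ob (Fun A C) \<longleftrightarrow> is_functor A C F"
  by (simp add: Fun_def)

lemma Ar_Fun: "\<alpha> \<in> Ar (Fun A C) \<longleftrightarrow> is_nattrans A C \<alpha>"
  by (simp add: Fun_def)

lemma hom_Fun_iff: "\<alpha> \<in> hom (Fun A C) F G \<longleftrightarrow> is_nattrans A C \<alpha> \<and> nsrc \<alpha> = F \<and> ntgt \<alpha> = G"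
  by (simp add: hom_def Fun_def)

lemma hom_FunD:
  assumes "\<alpha> \<in> hom (Fun A C) F G"
  shows "is_functor A C F" "is_functor A C G"
    and "x \<in> Ob A \<Longrightarrow> ncomp \<alpha> x \<in> hom C (fob F x) (fob G x)"
    and "u \<in> hom A x y \<Longrightarrow> ncomp \<alpha> y \<cdot>\<^bsub>C\<^esub> far F u = far G u \<cdot>\<^bsub>C\<^esub> ncomp \<alpha> x"
  using assms by (auto simp: hom_Fun_iff is_nattrans_def hom_iff[of _ A])

lemma hom_FunI:
  assumes "is_functor A C F" "is_functor A C G"
    and "\<And>x. x \<in> Ob A \<Longrightarrow> t x \<in> hom C (fob F x) (fob G x)"
    and "\<And>u x y. u \<in> hom A x y \<Longrightarrow> t y \<cdot>\<^bsub>C\<^esub> far F u = far G u \<cdot>\<^bsub>C\<^esub> t x"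
  shows "\<lparr>nsrc = F, ntgt = G, ncomp = restrict t (Ob A)\<rparr> \<in> hom (Fun A C) F G"
proof -
  interpret category A using is_functorD(1)[OF assms(1)] .
  show ?thesis
    using assms src_Ob tgt_Ob by (auto simp: hom_Fun_iff is_nattrans_def hom_iff[of _ A])
qed

lemma hom_Fun_eqI:
  assumes "\<alpha> \<in> hom (Fun A C) F G" "\<beta> \<in> hom (Fun A C) F G" "\<And>x. x \<in> Ob A \<Longrightarrow> ncomp \<alpha> x = ncomp \<beta> x"
  shows "\<alpha> = \<beta>"
proof -
  have "ncomp \<alpha> = ncomp \<beta>"
    using assms by (intro extensionalityI[of _ "Ob A"]) (auto simp: hom_Fun_iff is_nattrans_def)
  then show ?thesis using assms by (intro nattrans.equality) (auto simp: hom_Fun_iff)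
qed

lemma ncomp_cmp: "x \<in> Ob A \<Longrightarrow> ncomp (\<beta> \<cdot>\<^bsub>Fun A C\<^esub> \<alpha>) x = ncomp \<beta> x \<cdot>\<^bsub>C\<^esub> ncomp \<alpha> x"
  by (simp add: Fun_def)

lemma ncomp_ide: "x \<in> Ob A \<Longrightarrow> ncomp (ide (Fun A C) F) x = ide C (fob F x)"
  by (simp add: Fun_def)

section \<open>Evaluation at an object and its right adjoint\<close>

definition eval_diagram :: "('j, 'i) cat \<Rightarrow>
    ('j, 'i, ('x, 'y, 'o, 'a) cfunctor, ('x, 'y, 'o, 'a) nattrans) cfunctor \<Rightarrow> 'x \<Rightarrow>
    ('j, 'i, 'o, 'a) cfunctor" where
  "eval_diagram J G x =
    \<lparr>fob = restrict (\<lambda>j. fob (fob G j) x) (Ob J), far = restrict (\<lambda>u. ncomp (far G u) x) (Ar J)\<rparr>"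

lemma eval_diagram_simps:
  shows "j \<in> Ob J \<Longrightarrow> fob (eval_diagram J G x) j = fob (fob G j) x"
    and "u \<in> hom J i j \<Longrightarrow> far (eval_diagram J G x) u = ncomp (far G u) x"
  by (auto simp: eval_diagram_def hom_iff)

lemma is_functor_eval_diagram:
  assumes G: "is_functor J (Fun A C) G" and C: "category C" and x: "x \<in> Ob A"
  shows "is_functor J C (eval_diagram J G x)"
proof -
  interpret J: category J using is_functorD(1)[OF G] .
  show ?thesis
  proof (rule is_functorI)
    fix i assume i: "i \<in> Ob J"
    then have "is_functor A C (fob G i)" using is_functorD(3)[OF G] Ob_Fun by blast
    then show "fob (eval_diagram J G x) i \<in> Ob C"
      using i by (simp add: eval_diagram_simps is_functorD(3) x)
    show "far (eval_diagram J G x) (ide J i) = ide C (fob (eval_diagram J G x) i)"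
      using i by (simp add: eval_diagram_simps eval_diagram_simps(2)[OF J.ide_hom] is_functorD(5)[OF G]
          ncomp_ide x)
  next
    fix u i j assume u: "u \<in> hom J i j"
    show "far (eval_diagram J G x) u \<in> hom C (fob (eval_diagram J G x) i) (fob (eval_diagram J G x) j)"
      using hom_FunD(3)[OF is_functorD(4)[OF G u] x] J.hom_src_Ob[OF u] J.hom_tgt_Ob[OF u]
      by (simp add: eval_diagram_simps(1) eval_diagram_simps(2)[OF u])
    fix v k assume v: "v \<in> hom J j k"
    show "far (eval_diagram J G x) (v \<cdot>\<^bsub>J\<^esub> u)
      = far (eval_diagram J G x) v \<cdot>\<^bsub>C\<^esub> far (eval_diagram J G x) u"
      by (simp add: eval_diagram_simps(2)[OF u] eval_diagram_simps(2)[OF v]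
          eval_diagram_simps(2)[OF J.cmp_hom[OF u v]] is_functorD(6)[OF G u v] ncomp_cmp x)
  qed (auto simp: eval_diagram_def C J.category_axioms)
qed

lemma eval_cocone:
  assumes G: "is_functor J (Fun A C) G" and \<gamma>: "is_cocone J (Fun A C) G F \<gamma>" and x: "x \<in> Ob A"
  shows "is_cocone J C (eval_diagram J G x) (fob F x) (\<lambda>j. ncomp (\<gamma> j) x)"
proof -
  interpret J: category J using is_functorD(1)[OF G] .
  show ?thesis
  proof (rule is_coconeI)
    have "is_functor A C F" using is_coconeD(1)[OF \<gamma>] Ob_Fun by blast
    then show "fob F x \<in> Ob C" by (rule is_functorD(3)[OF _ x])
    fix j assume j: "j \<in> Ob J"
    then show "ncomp (\<gamma> j) x \<in> hom C (fob (eval_diagram J G x) j) (fob F x)"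
      using hom_FunD(3)[OF is_coconeD(2)[OF \<gamma> j] x] by (simp add: eval_diagram_simps)
  next
    fix u i j assume u: "u \<in> hom J i j"
    show "ncomp (\<gamma> j) x \<cdot>\<^bsub>C\<^esub> far (eval_diagram J G x) u = ncomp (\<gamma> i) x"
      using is_coconeD(3)[OF \<gamma> u] ncomp_cmp[OF x, of C "\<gamma> j" "far G u"]
      by (simp add: eval_diagram_simps(2)[OF u])
  qed
qed

text \<open>The pair \<open>(R, e)\<close> is a universal arrow from the functor "evaluate at
  \<open>x\<close>" to the object \<open>d\<close>. Having one for every \<open>d\<close> amounts to
  a right adjoint of evaluation, whose counit at \<open>d\<close> is \<open>e\<close>.\<close>

definition couniversal :: "('x, 'y) cat \<Rightarrow> ('o, 'a) cat \<Rightarrow> 'x \<Rightarrow> 'o \<Rightarrow> ('x, 'y, 'o, 'a) cfunctor \<Rightarrow> 'a \<Rightarrow> bool"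
  where "couniversal A C x d R e \<longleftrightarrow> is_functor A C R \<and> e \<in> hom C (fob R x) d \<and>
    (\<forall>H t. is_functor A C H \<and> t \<in> hom C (fob H x) d \<longrightarrow>
      (\<exists>!\<alpha>. \<alpha> \<in> hom (Fun A C) H R \<and> e \<cdot>\<^bsub>C\<^esub> ncomp \<alpha> x = t))"

text \<open>A left adjoint preserves colimits. The argument works with the individual universal
  arrows, and covers whatever colimit cocone is given in the functor category, with no assumption
  that \<open>C\<close> has colimits of shape \<open>J\<close>.\<close>

lemma eval_colimit:
  assumes G: "is_functor J (Fun A C) G" and C: "category C" and x: "x \<in> Ob A"
    and col: "is_colimit J (Fun A C) G F \<gamma>"
    and couniv: "\<And>d. d \<in> Ob C \<Longrightarrow> \<exists>R e. couniversal A C x d R e"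
  shows "is_colimit J C (eval_diagram J G x) (fob F x) (\<lambda>j. ncomp (\<gamma> j) x)"
proof (rule is_colimitI)
  interpret J: category J using is_functorD(1)[OF G] .
  interpret C: category C by fact
  interpret Fun: category "Fun A C" using is_functorD(2)[OF G] .
  note \<gamma> = colimit_cocone[OF col]
  note \<gamma>_hom = is_coconeD(2)[OF \<gamma>]
  show "is_cocone J C (eval_diagram J G x) (fob F x) (\<lambda>j. ncomp (\<gamma> j) x)"
    by (rule eval_cocone[OF G \<gamma> x])
  have F: "is_functor A C F" using is_coconeD(1)[OF \<gamma>] Ob_Fun by blast
  have Gj: "is_functor A C (fob G j)" if "j \<in> Ob J" for j
    using is_functorD(3)[OF G that] Ob_Fun by blast
  fix d
  {
    fix \<delta> assume \<delta>: "is_cocone J C (eval_diagram J G x) d \<delta>"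
    obtain R e where R: "couniversal A C x d R e" using couniv[OF is_coconeD(1)[OF \<delta>]] by blast
    then have e: "e \<in> hom C (fob R x) d" "is_functor A C R" by (simp_all add: couniversal_def)
    have \<delta>_hom: "\<delta> j \<in> hom C (fob (fob G j) x) d" if "j \<in> Ob J" for j
      using is_coconeD(2)[OF \<delta> that] that by (simp add: eval_diagram_simps)
    \<comment> \<open>Each \<delta> j is transposed along \<open>e\<close>; uniqueness of transposes
      then turns the compatibility of \<delta> into that of the natural transformations
      \<alpha>.\<close>
    have "\<exists>\<alpha>. \<alpha> \<in> hom (Fun A C) (fob G j) R \<and> e \<cdot>\<^bsub>C\<^esub> ncomp \<alpha> x = \<delta> j" if "j \<in> Ob J" for j
      using R Gj[OF that] \<delta>_hom[OF that] unfolding couniversal_def by blast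
    then obtain \<alpha> where \<alpha>: "\<And>j. j \<in> Ob J \<Longrightarrow> \<alpha> j \<in> hom (Fun A C) (fob G j) R"
      "\<And>j. j \<in> Ob J \<Longrightarrow> e \<cdot>\<^bsub>C\<^esub> ncomp (\<alpha> j) x = \<delta> j"
      by metis
    have "is_cocone J (Fun A C) G R \<alpha>"
    proof (rule is_coconeI)
      show "R \<in> Ob (Fun A C)" using e by (simp add: Ob_Fun)
      show "\<And>j. j \<in> Ob J \<Longrightarrow> \<alpha> j \<in> hom (Fun A C) (fob G j) R" by fact
      fix u i j assume u: "u \<in> hom J i j"
      note ij = J.hom_src_Ob[OF u] J.hom_tgt_Ob[OF u]
      note Gu = is_functorD(4)[OF G u]
      have "e \<cdot>\<^bsub>C\<^esub> ncomp (\<alpha> j \<cdot>\<^bsub>Fun A C\<^esub> far G u) x = \<delta> i"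
        using C.cmp_assoc[OF hom_FunD(3)[OF Gu x] hom_FunD(3)[OF \<alpha>(1)[OF ij(2)] x] e(1)]
          is_coconeD(3)[OF \<delta> u] \<alpha>(2)[OF ij(2)]
        by (simp add: ncomp_cmp[OF x] eval_diagram_simps(2)[OF u])
      moreover have "\<alpha> j \<cdot>\<^bsub>Fun A C\<^esub> far G u \<in> hom (Fun A C) (fob G i) R"
        by (rule Fun.cmp_hom[OF Gu \<alpha>(1)[OF ij(2)]])
      ultimately show "\<alpha> j \<cdot>\<^bsub>Fun A C\<^esub> far G u = \<alpha> i"
        using R Gj[OF ij(1)] \<delta>_hom[OF ij(1)] \<alpha>[OF ij(1)] unfolding couniversal_def by blast
    qed
    then obtain \<beta> where \<beta>: "\<beta> \<in> hom (Fun A C) F R" "\<And>j. j \<in> Ob J \<Longrightarrow> \<beta> \<cdot>\<^bsub>Fun A C\<^esub> \<gamma> j = \<alpha> j"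
      using colimit_factor[OF col] by blast
    note \<beta>x = hom_FunD(3)[OF \<beta>(1) x]
    have "(e \<cdot>\<^bsub>C\<^esub> ncomp \<beta> x) \<cdot>\<^bsub>C\<^esub> ncomp (\<gamma> j) x = \<delta> j" if j: "j \<in> Ob J" for j
      using C.cmp_assoc[OF hom_FunD(3)[OF \<gamma>_hom[OF j] x] \<beta>x e(1)] \<alpha>(2)[OF j]
      by (simp add: \<beta>(2)[OF j, symmetric] ncomp_cmp[OF x])
    then show "\<exists>h\<in>hom C (fob F x) d. \<forall>j\<in>Ob J. h \<cdot>\<^bsub>C\<^esub> ncomp (\<gamma> j) x = \<delta> j"
      using C.cmp_hom[OF \<beta>x e(1)] by blast
  }
  fix h h' assume h: "h \<in> hom C (fob F x) d" "h' \<in> hom C (fob F x) d"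
    "\<forall>j\<in>Ob J. h \<cdot>\<^bsub>C\<^esub> ncomp (\<gamma> j) x = h' \<cdot>\<^bsub>C\<^esub> ncomp (\<gamma> j) x"
  obtain R e where R: "couniversal A C x d R e" using couniv[OF C.hom_tgt_Ob[OF h(1)]] by blast
  then have e: "e \<in> hom C (fob R x) d" by (simp add: couniversal_def)
  obtain \<beta> where \<beta>: "\<beta> \<in> hom (Fun A C) F R" "e \<cdot>\<^bsub>C\<^esub> ncomp \<beta> x = h"
    using R F h(1) unfolding couniversal_def by blast
  obtain \<beta>' where \<beta>': "\<beta>' \<in> hom (Fun A C) F R" "e \<cdot>\<^bsub>C\<^esub> ncomp \<beta>' x = h'"
    using R F h(2) unfolding couniversal_def by blast
  have "\<beta> = \<beta>'"
  proof (rule colimit_eqI[OF G col \<beta>(1) \<beta>'(1)])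
    fix j assume j: "j \<in> Ob J"
    note \<gamma>x = hom_FunD(3)[OF \<gamma>_hom[OF j] x]
    have 1: "e \<cdot>\<^bsub>C\<^esub> ncomp (\<beta> \<cdot>\<^bsub>Fun A C\<^esub> \<gamma> j) x = h \<cdot>\<^bsub>C\<^esub> ncomp (\<gamma> j) x"
      using C.cmp_assoc[OF \<gamma>x hom_FunD(3)[OF \<beta>(1) x] e] by (simp add: ncomp_cmp[OF x] \<beta>(2))
    have 2: "e \<cdot>\<^bsub>C\<^esub> ncomp (\<beta>' \<cdot>\<^bsub>Fun A C\<^esub> \<gamma> j) x = h \<cdot>\<^bsub>C\<^esub> ncomp (\<gamma> j) x"
      using C.cmp_assoc[OF \<gamma>x hom_FunD(3)[OF \<beta>'(1) x] e] h(3) j by (simp add: ncomp_cmp[OF x] \<beta>'(2))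
    show "\<beta> \<cdot>\<^bsub>Fun A C\<^esub> \<gamma> j = \<beta>' \<cdot>\<^bsub>Fun A C\<^esub> \<gamma> j"
      using R Gj[OF j] C.cmp_hom[OF \<gamma>x h(1)] Fun.cmp_hom[OF \<gamma>_hom[OF j] \<beta>(1)]
        Fun.cmp_hom[OF \<gamma>_hom[OF j] \<beta>'(1)] 1 2
      unfolding couniversal_def by blast
  qed
  then show "h = h'" using \<beta>(2) \<beta>'(2) by simp
qed

section \<open>The cospan category and functors on it\<close>

lemma Ob_cospan_cat [simp]: "x \<in> Ob \<Lambda>"
  by (simp add: cospan_cat_def)

lemma hom_cospan_cat_iff: "u \<in> hom \<Lambda> x y \<longleftrightarrow> u = (x, y) \<and> (x = y \<or> y = Mid)"
  by (auto simp: cospan_cat_def hom_def)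

lemma ide_cospan_cat [simp]: "ide \<Lambda> x = (x, x)"
  by (simp add: cospan_cat_def)

lemma hom_cospan_cat [simp]: "(Lft, Mid) \<in> hom \<Lambda> Lft Mid" "(Rgt, Mid) \<in> hom \<Lambda> Rgt Mid"
  by (auto simp: hom_cospan_cat_iff)

lemma hom_cospan_cat_cases:
  assumes "u \<in> hom \<Lambda> x y"
  obtains "x = y" "u = ide \<Lambda> x" | "x = Lft" "y = Mid" "u = (Lft, Mid)"
    | "x = Rgt" "y = Mid" "u = (Rgt, Mid)"
  using assms by (cases x) (auto simp: hom_cospan_cat_iff)

definition cospan :: "('o, 'a) cat \<Rightarrow> 'o \<Rightarrow> 'o \<Rightarrow> 'o \<Rightarrow> 'a \<Rightarrow> 'a \<Rightarrow>
    (cospan_ob, cospan_ob \<times> cospan_ob, 'o, 'a) cfunctor" where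
  "cospan C a m b f g = (let F = (\<lambda>x. case x of Lft \<Rightarrow> a | Mid \<Rightarrow> m | Rgt \<Rightarrow> b) in
     \<lparr>fob = F, far = restrict (\<lambda>(x, y). if x = y then ide C (F x) else if x = Lft then f else g) (Ar \<Lambda>)\<rparr>)"

lemma cospan_simps [simp]:
  "fob (cospan C a m b f g) Lft = a" "fob (cospan C a m b f g) Mid = m"
  "fob (cospan C a m b f g) Rgt = b"
  "far (cospan C a m b f g) (Lft, Mid) = f" "far (cospan C a m b f g) (Rgt, Mid) = g"
  "far (cospan C a m b f g) (x, x) = ide C (fob (cospan C a m b f g) x)"
  by (auto simp: cospan_def cospan_cat_def Let_def)

lemma is_functor_cospan:
  assumes "category C" "f \<in> hom C a m" "g \<in> hom C b m"
  shows "is_functor \<Lambda> C (cospan C a m b f g)"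
proof -
  interpret category C by fact
  have Ob: "fob (cospan C a m b f g) x \<in> Ob C" for x
    using assms hom_src_Ob hom_tgt_Ob by (cases x) auto
  have far: "far (cospan C a m b f g) u \<in> hom C (fob (cospan C a m b f g) x) (fob (cospan C a m b f g) y)"
    if "u \<in> hom \<Lambda> x y" for u x y
    using that ide_hom[OF Ob] assms
    by (cases rule: hom_cospan_cat_cases) auto
  show ?thesis
  proof (rule is_functorI)
    fix u v x y z assume u: "u \<in> hom \<Lambda> x y" and v: "v \<in> hom \<Lambda> y z"
    have "x = y \<and> u = (x, x) \<or> y = z \<and> v = (y, y)"
      using u v by (auto simp: hom_cospan_cat_iff)
    then show "far (cospan C a m b f g) (v \<cdot>\<^bsub>\<Lambda>\<^esub> u)
      = far (cospan C a m b f g) v \<cdot>\<^bsub>C\<^esub> far (cospan C a m b f g) u"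
      using cmp_ide[OF far[OF v]] ide_cmp[OF far[OF u]] u v
      by (auto simp: cospan_cat_def hom_cospan_cat_iff[unfolded cospan_cat_def])
  next
    fix x show "far (cospan C a m b f g) (ide \<Lambda> x) = ide C (fob (cospan C a m b f g) x)"
      by simp
  next
    show "fob (cospan C a m b f g) \<in> extensional (Ob \<Lambda>)" "far (cospan C a m b f g) \<in> extensional (Ar \<Lambda>)"
      by (auto simp: cospan_def Let_def extensional_def)
  qed (use Ob far in \<open>auto simp: category_cospan assms(1)\<close>)
qed

lemma hom_cospanI:
  assumes F: "is_functor \<Lambda> C F" and G: "is_functor \<Lambda> C G"
    and t: "\<And>x. t x \<in> hom C (fob F x) (fob G x)"
    and L: "t Mid \<cdot>\<^bsub>C\<^esub> far F (Lft, Mid) = far G (Lft, Mid) \<cdot>\<^bsub>C\<^esub> t Lft"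
    and R: "t Mid \<cdot>\<^bsub>C\<^esub> far F (Rgt, Mid) = far G (Rgt, Mid) \<cdot>\<^bsub>C\<^esub> t Rgt"
  shows "\<lparr>nsrc = F, ntgt = G, ncomp = t\<rparr> \<in> hom (Fun \<Lambda> C) F G"
proof -
  interpret category C using is_functorD(2)[OF F] .
  have "\<lparr>nsrc = F, ntgt = G, ncomp = restrict t (Ob \<Lambda>)\<rparr> \<in> hom (Fun \<Lambda> C) F G"
  proof (rule hom_FunI[OF F G t])
    fix u x y assume "u \<in> hom \<Lambda> x y"
    then show "t y \<cdot>\<^bsub>C\<^esub> far F u = far G u \<cdot>\<^bsub>C\<^esub> t x"
      using L R is_functorD(5)[OF F, of x] is_functorD(5)[OF G, of x] cmp_ide[OF t] ide_cmp[OF t]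
      by (cases rule: hom_cospan_cat_cases) auto
  qed
  moreover have "restrict t (Ob \<Lambda>) = t" by (simp add: restrict_def)
  ultimately show ?thesis by simp
qed

text \<open>The limit of the empty diagram. The object is wanted as the filler in the right Kan
  extensions along \<open>Lft\<close> and \<open>Rgt\<close>.\<close>

lemma complete_terminal:
  assumes "category C" "complete_cat (U :: 'u rel) C" "regular_cardinal U"
  obtains T where "T \<in> Ob C" "\<And>x. x \<in> Ob C \<Longrightarrow> \<exists>!t. t \<in> hom C x T"
proof -
  let ?D = "discrete_functor {} C undefined"
  have D: "is_functor (discrete_cat ({} :: 'u set)) C ?D"
    by (rule is_functor_discrete[OF assms(1)]) simp
  have "small_cat U (discrete_cat {})"
    using finite_card_less[OF assms(3), of "{}"] by (simp add: small_cat_def category_discrete)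
  then obtain T \<pi> where T: "is_limit (discrete_cat ({} :: 'u set)) C ?D T \<pi>"
    using D assms(2) unfolding complete_cat_def by blast
  show thesis
  proof (rule that)
    show "T \<in> Ob C" using is_coneD(1)[OF limit_cone[OF T]] .
    fix x assume "x \<in> Ob C"
    then have "is_cone (discrete_cat {}) C ?D x \<pi>" by (simp add: is_cone_def)
    then have "\<exists>!h. h \<in> hom C x T \<and> (\<forall>j\<in>Ob (discrete_cat {}). \<pi> j \<cdot>\<^bsub>C\<^esub> h = \<pi> j)"
      using T unfolding is_limit_def by blast
    then show "\<exists>!t. t \<in> hom C x T" by simp
  qed
qed

text \<open>
  The right Kan extensions along the inclusion of an object of \<open>\<Lambda>\<close> are constant functors and
  cospans over the terminal object.
\<close>

lemma couniversal_cospan: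
  assumes C: "category C" and T: "T \<in> Ob C" "\<And>x. x \<in> Ob C \<Longrightarrow> \<exists>!t. t \<in> hom C x T" and d: "d \<in> Ob C"
  shows "\<exists>R. couniversal \<Lambda> C x d R (ide C d)"
proof -
  interpret category C by fact
  obtain b where b: "\<And>x. x \<in> Ob C \<Longrightarrow> b x \<in> hom C x T" using T(2) by metis
  have eqT: "f = g" if "f \<in> hom C x T" "g \<in> hom C x T" for f g x
    using that T(2)[OF hom_src_Ob[OF that(1)]] by blast
  note id = ide_hom[OF d] ide_hom[OF T(1)]
  show ?thesis
  \<comment> \<open>The right Kan extension of \<open>d\<close> along \<open>x\<close> takes at
    \<open>y\<close> the power of \<open>d\<close> indexed by the arrows from \<open>y\<close> to
    \<open>x\<close>. Into \<open>Mid\<close> there is exactly one arrow from each object, so every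
    value is \<open>d\<close>. Into \<open>Lft\<close> or \<open>Rgt\<close> there is only the
    identity, so the value is \<open>d\<close> at \<open>x\<close> and terminal elsewhere.\<close>
  proof (cases "x = Mid")
    case True
    let ?R = "cospan C d d d (ide C d) (ide C d)"
    note R = is_functor_cospan[OF C id(1) id(1)]
    have const: "fob ?R y = d" for y by (cases y) auto
    have "\<exists>!\<alpha>. \<alpha> \<in> hom (Fun \<Lambda> C) H ?R \<and> ide C d \<cdot>\<^bsub>C\<^esub> ncomp \<alpha> Mid = t"
      if H: "is_functor \<Lambda> C H" and t: "t \<in> hom C (fob H Mid) d" for H t
    proof -
      let ?t = "\<lambda>y. case y of Mid \<Rightarrow> t | _ \<Rightarrow> t \<cdot>\<^bsub>C\<^esub> far H (y, Mid)"
      note HL = is_functorD(4)[OF H hom_cospan_cat(1)]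
      note HR = is_functorD(4)[OF H hom_cospan_cat(2)]
      have tL: "t \<cdot>\<^bsub>C\<^esub> far H (Lft, Mid) \<in> hom C (fob H Lft) d" by (rule cmp_hom[OF HL t])
      have tR: "t \<cdot>\<^bsub>C\<^esub> far H (Rgt, Mid) \<in> hom C (fob H Rgt) d" by (rule cmp_hom[OF HR t])
      have "?t y \<in> hom C (fob H y) (fob ?R y)" for y
        using t tL tR by (cases y) auto
      then have "\<lparr>nsrc = H, ntgt = ?R, ncomp = ?t\<rparr> \<in> hom (Fun \<Lambda> C) H ?R"
        by (rule hom_cospanI[OF H R]) (simp_all add: ide_cmp[OF tL] ide_cmp[OF tR])
      moreover have "ide C d \<cdot>\<^bsub>C\<^esub> ncomp \<lparr>nsrc = H, ntgt = ?R, ncomp = ?t\<rparr> Mid = t"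
        by (simp add: ide_cmp[OF t])
      moreover have "\<alpha> = \<beta>"
        if \<alpha>: "\<alpha> \<in> hom (Fun \<Lambda> C) H ?R" "ide C d \<cdot>\<^bsub>C\<^esub> ncomp \<alpha> Mid = t"
          and \<beta>: "\<beta> \<in> hom (Fun \<Lambda> C) H ?R" "ide C d \<cdot>\<^bsub>C\<^esub> ncomp \<beta> Mid = t" for \<alpha> \<beta>
      proof (rule hom_Fun_eqI[OF \<alpha>(1) \<beta>(1)])
        have determined: "ncomp \<sigma> y = ?t y"
          if \<sigma>: "\<sigma> \<in> hom (Fun \<Lambda> C) H ?R" "ide C d \<cdot>\<^bsub>C\<^esub> ncomp \<sigma> Mid = t" for \<sigma> y
        proof -
          have c: "ncomp \<sigma> z \<in> hom C (fob H z) d" for z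
            using hom_FunD(3)[OF \<sigma>(1), of z] const by simp
          show ?thesis
            using \<sigma>(2) ide_cmp[OF c, of y] ide_cmp[OF c, of Mid]
              hom_FunD(4)[OF \<sigma>(1) hom_cospan_cat(1)] hom_FunD(4)[OF \<sigma>(1) hom_cospan_cat(2)]
            by (cases y) auto
        qed
        fix y show "ncomp \<alpha> y = ncomp \<beta> y" using determined[OF \<alpha>] determined[OF \<beta>] by simp
      qed
      ultimately show ?thesis by blast
    qed
    then have "couniversal \<Lambda> C Mid d ?R (ide C d)"
      using R id unfolding couniversal_def by auto
    then show ?thesis using True by blast
  next
    case False
    define F where "F y = (if y = x then d else T)" for y
    let ?R = "cospan C (F Lft) T (F Rgt) (b (F Lft)) (b (F Rgt))"
    have bF: "b (F y) \<in> hom C (F y) T" for y using b d T(1) by (simp add: F_def)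
    note R = is_functor_cospan[OF C bF bF, of Lft Rgt]
    have fobR: "fob ?R y = F y" for y using False by (cases y) (auto simp: F_def)
    have "\<exists>!\<alpha>. \<alpha> \<in> hom (Fun \<Lambda> C) H ?R \<and> ide C d \<cdot>\<^bsub>C\<^esub> ncomp \<alpha> x = t"
      if H: "is_functor \<Lambda> C H" and t: "t \<in> hom C (fob H x) d" for H t
    proof -
      let ?t = "\<lambda>y. if y = x then t else b (fob H y)"
      note HL = is_functorD(4)[OF H hom_cospan_cat(1)]
      note HR = is_functorD(4)[OF H hom_cospan_cat(2)]
      note bH = b[OF is_functorD(3)[OF H Ob_cospan_cat]]
      have tF: "?t y \<in> hom C (fob H y) (F y)" for y
        using t bH by (auto simp: F_def)
      then have "?t y \<in> hom C (fob H y) (fob ?R y)" for y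
        using fobR by simp
      moreover have "?t Mid = b (fob H Mid)" using False by auto
      ultimately have "\<lparr>nsrc = H, ntgt = ?R, ncomp = ?t\<rparr> \<in> hom (Fun \<Lambda> C) H ?R"
        using eqT[OF cmp_hom[OF HL bH] cmp_hom[OF tF bF]] eqT[OF cmp_hom[OF HR bH] cmp_hom[OF tF bF]]
        by (intro hom_cospanI[OF H R]) (simp_all only: cospan_simps)
      moreover have "ide C d \<cdot>\<^bsub>C\<^esub> ncomp \<lparr>nsrc = H, ntgt = ?R, ncomp = ?t\<rparr> x = t"
        by (simp add: ide_cmp[OF t])
      moreover have "\<alpha> = \<beta>"
        if \<alpha>: "\<alpha> \<in> hom (Fun \<Lambda> C) H ?R" "ide C d \<cdot>\<^bsub>C\<^esub> ncomp \<alpha> x = t"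
          and \<beta>: "\<beta> \<in> hom (Fun \<Lambda> C) H ?R" "ide C d \<cdot>\<^bsub>C\<^esub> ncomp \<beta> x = t" for \<alpha> \<beta>
      proof (rule hom_Fun_eqI[OF \<alpha>(1) \<beta>(1)])
        fix y
        have y: "ncomp \<alpha> y \<in> hom C (fob H y) (F y)" "ncomp \<beta> y \<in> hom C (fob H y) (F y)"
          using hom_FunD(3)[OF \<alpha>(1), of y] hom_FunD(3)[OF \<beta>(1), of y] fobR by simp_all
        show "ncomp \<alpha> y = ncomp \<beta> y"
        proof (cases "y = x")
          case True
          then show ?thesis
            using \<alpha>(2) \<beta>(2) ide_cmp[OF y(1)] ide_cmp[OF y(2)] by (simp add: F_def)
        next
          case False
          then show ?thesis using y eqT by (simp add: F_def)
        qed
      qed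
      ultimately show ?thesis by blast
    qed
    moreover have "fob ?R x = d" using fobR by (simp add: F_def)
    ultimately have "couniversal \<Lambda> C x d ?R (ide C d)"
      using R id unfolding couniversal_def by auto
    then show ?thesis by blast
  qed
qed

section \<open>Pullback functors\<close>

text \<open>Fixes the limit cones \<pi> that \<open>is_limit_functor\<close> merely asserts to
  exist, together with their naturality, so that maps into pullbacks can be built and compared
  through the two outer projections.\<close>

locale pullback_functor = C: category C for C :: "('o, 'a) cat" +
  fixes P :: "((cospan_ob, cospan_ob \<times> cospan_ob, 'o, 'a) cfunctor,
              (cospan_ob, cospan_ob \<times> cospan_ob, 'o, 'a) nattrans, 'o, 'a) cfunctor"
    and \<pi> :: "(cospan_ob, cospan_ob \<times> cospan_ob, 'o, 'a) cfunctor \<Rightarrow> cospan_ob \<Rightarrow> 'a"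
  assumes P: "is_functor (Fun \<Lambda> C) C P"
    and pullback: "\<And>F. is_functor \<Lambda> C F \<Longrightarrow> is_limit \<Lambda> C F (fob P F) (\<pi> F)"
    and proj_natural: "\<And>\<alpha> F G x. \<alpha> \<in> hom (Fun \<Lambda> C) F G \<Longrightarrow>
      \<pi> G x \<cdot>\<^bsub>C\<^esub> far P \<alpha> = ncomp \<alpha> x \<cdot>\<^bsub>C\<^esub> \<pi> F x"
begin

lemma proj_hom: "is_functor \<Lambda> C F \<Longrightarrow> \<pi> F x \<in> hom C (fob P F) (fob F x)"
  using is_coneD(2)[OF limit_cone[OF pullback]] by simp

lemma proj_cone: "is_functor \<Lambda> C F \<Longrightarrow> u \<in> hom \<Lambda> x y \<Longrightarrow> far F u \<cdot>\<^bsub>C\<^esub> \<pi> F x = \<pi> F y"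
  using is_coneD(3)[OF limit_cone[OF pullback]] by blast

lemma pullback_eqI:
  assumes F: "is_functor \<Lambda> C F" and h: "h \<in> hom C s (fob P F)" "h' \<in> hom C s (fob P F)"
    and L: "\<pi> F Lft \<cdot>\<^bsub>C\<^esub> h = \<pi> F Lft \<cdot>\<^bsub>C\<^esub> h'" and R: "\<pi> F Rgt \<cdot>\<^bsub>C\<^esub> h = \<pi> F Rgt \<cdot>\<^bsub>C\<^esub> h'"
  shows "h = h'"
proof (rule limit_eqI[OF F pullback[OF F] h])
  note FL = is_functorD(4)[OF F hom_cospan_cat(1)]
  have "\<pi> F Mid \<cdot>\<^bsub>C\<^esub> h = \<pi> F Mid \<cdot>\<^bsub>C\<^esub> h'"
    using C.cmp_assoc[OF h(1) proj_hom[OF F] FL] C.cmp_assoc[OF h(2) proj_hom[OF F] FL]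
      proj_cone[OF F hom_cospan_cat(1)] L by simp
  then show "\<pi> F x \<cdot>\<^bsub>C\<^esub> h = \<pi> F x \<cdot>\<^bsub>C\<^esub> h'" for x
    using L R by (cases x) auto
qed

lemma pullback_factor:
  assumes F: "is_functor \<Lambda> C F" and a: "a \<in> hom C s (fob F Lft)" and b: "b \<in> hom C s (fob F Rgt)"
    and ab: "far F (Lft, Mid) \<cdot>\<^bsub>C\<^esub> a = far F (Rgt, Mid) \<cdot>\<^bsub>C\<^esub> b"
  obtains h where "h \<in> hom C s (fob P F)" "\<pi> F Lft \<cdot>\<^bsub>C\<^esub> h = a" "\<pi> F Rgt \<cdot>\<^bsub>C\<^esub> h = b"
proof -
  let ?\<rho> = "\<lambda>x. case x of Lft \<Rightarrow> a | Mid \<Rightarrow> far F (Lft, Mid) \<cdot>\<^bsub>C\<^esub> a | Rgt \<Rightarrow> b"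
  have \<rho>: "?\<rho> x \<in> hom C s (fob F x)" for x
    using a b C.cmp_hom[OF a is_functorD(4)[OF F hom_cospan_cat(1)]] by (cases x) auto
  have "is_cone \<Lambda> C F s ?\<rho>"
  proof (rule is_coneI)
    fix u x y assume "u \<in> hom \<Lambda> x y"
    then show "far F u \<cdot>\<^bsub>C\<^esub> ?\<rho> x = ?\<rho> y"
      using ab C.ide_cmp[OF \<rho>] is_functorD(5)[OF F, of x] by (cases rule: hom_cospan_cat_cases) auto
  qed (use \<rho> C.hom_src_Ob[OF a] in auto)
  then obtain h where "h \<in> hom C s (fob P F)" "\<And>x. x \<in> Ob \<Lambda> \<Longrightarrow> \<pi> F x \<cdot>\<^bsub>C\<^esub> h = ?\<rho> x"
    using limit_factor[OF pullback[OF F]] by blast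
  then show thesis using that[of h] by simp
qed

end

lemma pullback_functor_ex:
  assumes "is_pullback_functor C P"
  shows "\<exists>\<pi>. pullback_functor C P \<pi>"
proof -
  obtain \<pi> where P: "is_functor (Fun \<Lambda> C) C P"
    and \<pi>: "\<forall>F\<in>Ob (Fun \<Lambda> C). is_limit \<Lambda> C F (fob P F) (\<pi> F)"
      "\<forall>\<alpha>\<in>Ar (Fun \<Lambda> C). \<forall>j\<in>Ob \<Lambda>. \<pi> (ntgt \<alpha>) j \<cdot>\<^bsub>C\<^esub> far P \<alpha> = ncomp \<alpha> j \<cdot>\<^bsub>C\<^esub> \<pi> (nsrc \<alpha>) j"
    using assms unfolding is_limit_functor_def by blast
  have "pullback_functor C P \<pi>"
    using is_functorD(2)[OF P] P \<pi>
    by (intro pullback_functor.intro pullback_functor_axioms.intro)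
      (auto simp: Ob_Fun Ar_Fun hom_Fun_iff)
  then show ?thesis by blast
qed

theorem presentable_pullback_accessible:
  fixes U :: "'u rel" and C :: "('o, 'a) cat"
  assumes U: "regular_cardinal U" and compl: "complete_cat U C" and pb: "is_pullback_functor C P"
    and pres: "presentable U C"
  shows "accessible_functor U (Fun \<Lambda> C) C P"
proof -
  obtain \<pi> where "pullback_functor C P \<pi>" using pullback_functor_ex[OF pb] by blast
  then interpret pullback_functor C P \<pi> .
  obtain \<kappa> S where \<kappa>: "small_regular U \<kappa>" and S: "\<And>s. s \<in> S \<Longrightarrow> compact_object U \<kappa> C s"
    and dense: "\<And>x. x \<in> Ob C \<Longrightarrow> \<exists>(J :: ('u, 'u) cat) D \<gamma>. small_cat U J \<and> filtered_cat \<kappa> J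
      \<and> is_functor J C D \<and> fob D ` Ob J \<subseteq> S \<and> is_colimit J C D x \<gamma>"
    using pres unfolding presentable_def by metis
  then have \<kappa>': "regular_cardinal \<kappa>" by (simp add: small_regular_def)
  obtain T where T: "T \<in> Ob C" "\<And>x. x \<in> Ob C \<Longrightarrow> \<exists>!t. t \<in> hom C x T"
    using complete_terminal[OF C.category_axioms compl U] by blast
  have "preserves_filtered_colimits U \<kappa> (Fun \<Lambda> C) C P"
    unfolding preserves_filtered_colimits_def
  proof (intro allI impI, elim conjE)
    fix J :: "('u, 'u) cat" and G F \<gamma>
    assume J: "small_cat U J" "filtered_cat \<kappa> J" and G: "is_functor J (Fun \<Lambda> C) G"
      and col: "is_colimit J (Fun \<Lambda> C) G F \<gamma>"
    interpret J: category J using is_functorD(1)[OF G] .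
    let ?E = "eval_diagram J G"
    have E: "is_functor J C (?E x)" for x by (rule is_functor_eval_diagram[OF G C.category_axioms]) simp
    have E_col: "is_colimit J C (?E x) (fob F x) (\<lambda>j. ncomp (\<gamma> j) x)" for x
    proof (rule eval_colimit[OF G C.category_axioms _ col])
      show "\<exists>R e. couniversal \<Lambda> C x d R e" if "d \<in> Ob C" for d
        using couniversal_cospan[OF C.category_axioms T that] by blast
    qed simp
    have fobE: "fob (?E x) j = fob (fob G j) x" if "j \<in> Ob J" for x j
      using that by (rule eval_diagram_simps)
    have F: "is_functor \<Lambda> C F" using is_coconeD(1)[OF colimit_cocone[OF col]] Ob_Fun by blast
    have Gj: "is_functor \<Lambda> C (fob G j)" if "j \<in> Ob J" for j
      using is_functorD(3)[OF G that] Ob_Fun by blast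
    note \<gamma> = is_coconeD(2)[OF colimit_cocone[OF col]]
    note \<gamma>x = hom_FunD(3)[OF \<gamma> Ob_cospan_cat]
    note P_far = is_functorD(4)[OF P]
    let ?K = "fcomp J P G"
    have K: "is_functor J C ?K" by (rule is_functor_fcomp[OF G P])
    have fobK: "fob ?K j = fob P (fob G j)" if "j \<in> Ob J" for j using that by (simp add: fcomp_simps)
    note farK = fcomp_simps(3)[of _ J _ _ P G]
    have \<theta>: "is_cocone J C ?K (fob P F) (\<lambda>j. far P (\<gamma> j))"
    proof (rule is_coconeI)
      show "fob P F \<in> Ob C" using is_functorD(3)[OF P] F Ob_Fun by blast
      show "far P (\<gamma> j) \<in> hom C (fob ?K j) (fob P F)" if "j \<in> Ob J" for j
        using P_far[OF \<gamma>[OF that]] fobK[OF that] by simp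
      fix u i j assume u: "u \<in> hom J i j"
      show "far P (\<gamma> j) \<cdot>\<^bsub>C\<^esub> far ?K u = far P (\<gamma> i)"
        using is_functorD(6)[OF P is_functorD(4)[OF G u] \<gamma>[OF J.hom_tgt_Ob[OF u]]]
          is_coconeD(3)[OF colimit_cocone[OF col] u] farK[OF u] by simp
    qed
    have proj_\<gamma>: "\<pi> F x \<cdot>\<^bsub>C\<^esub> (far P (\<gamma> j) \<cdot>\<^bsub>C\<^esub> g) = ncomp (\<gamma> j) x \<cdot>\<^bsub>C\<^esub> (\<pi> (fob G j) x \<cdot>\<^bsub>C\<^esub> g)"
      if j: "j \<in> Ob J" and g: "g \<in> hom C s (fob P (fob G j))" for x j g s
      using C.cmp_assoc[OF g P_far[OF \<gamma>[OF j]] proj_hom[OF F]]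
        C.cmp_assoc[OF g proj_hom[OF Gj[OF j]] \<gamma>x[OF j]] proj_natural[OF \<gamma>[OF j]] by simp
    have proj_u: "\<pi> (fob G k) x \<cdot>\<^bsub>C\<^esub> (far P (far G u) \<cdot>\<^bsub>C\<^esub> g)
        = far (?E x) u \<cdot>\<^bsub>C\<^esub> (\<pi> (fob G j) x \<cdot>\<^bsub>C\<^esub> g)"
      if u: "u \<in> hom J j k" and g: "g \<in> hom C s (fob P (fob G j))" for x j k u g s
      using C.cmp_assoc[OF g P_far[OF is_functorD(4)[OF G u]] proj_hom[OF Gj[OF J.hom_tgt_Ob[OF u]]]]
        C.cmp_assoc[OF g proj_hom[OF Gj[OF J.hom_src_Ob[OF u]]]
          hom_FunD(3)[OF is_functorD(4)[OF G u] Ob_cospan_cat]]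
        proj_natural[OF is_functorD(4)[OF G u]]
      by (simp add: eval_diagram_simps(2)[OF u])
    show "is_colimit J C ?K (fob P F) (\<lambda>j. far P (\<gamma> j))"
    proof (rule colimit_by_compact_objects[OF \<kappa>' S dense J(2) K \<theta>])
      fix s assume s: "s \<in> S"
      have ct: "compact_test U \<kappa> C J (?E x) (fob F x) (\<lambda>j. ncomp (\<gamma> j) x) s" for x
        using \<kappa>' S[OF s] J E E_col by unfold_locales
      note equal = compact_test.equal_at_stage[OF ct]
      {
        fix f assume f: "f \<in> hom C s (fob P F)"
        have pf: "\<pi> F x \<cdot>\<^bsub>C\<^esub> f \<in> hom C s (fob F x)" for x by (rule C.cmp_hom[OF f proj_hom[OF F]])
        obtain i a where i: "i \<in> Ob J" "a \<in> hom C s (fob (?E Lft) i)"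
          "ncomp (\<gamma> i) Lft \<cdot>\<^bsub>C\<^esub> a = \<pi> F Lft \<cdot>\<^bsub>C\<^esub> f"
          using compact_test.factors_through_stage[OF ct pf] by blast
        obtain j b where j: "j \<in> Ob J" "b \<in> hom C s (fob (?E Rgt) j)"
          "ncomp (\<gamma> j) Rgt \<cdot>\<^bsub>C\<^esub> b = \<pi> F Rgt \<cdot>\<^bsub>C\<^esub> f"
          using compact_test.factors_through_stage[OF ct pf] by blast
        obtain k v w where k: "k \<in> Ob J" "v \<in> hom J i k" "w \<in> hom J j k"
          using filtered_upper[OF \<kappa>' J(2) i(1) j(1)] by blast
        have push: "far (?E x) u \<cdot>\<^bsub>C\<^esub> g \<in> hom C s (fob (?E x) n)"
          "ncomp (\<gamma> n) x \<cdot>\<^bsub>C\<^esub> (far (?E x) u \<cdot>\<^bsub>C\<^esub> g) = ncomp (\<gamma> m) x \<cdot>\<^bsub>C\<^esub> g"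
          if u: "u \<in> hom J m n" and g: "g \<in> hom C s (fob (?E x) m)" for x u m n g
          using C.cmp_hom[OF g is_functorD(4)[OF E u]]
            C.cmp_assoc[OF g is_functorD(4)[OF E u]
              is_coconeD(2)[OF colimit_cocone[OF E_col] J.hom_tgt_Ob[OF u]]]
            is_coconeD(3)[OF colimit_cocone[OF E_col] u] by simp_all
        define a' where "a' = far (?E Lft) v \<cdot>\<^bsub>C\<^esub> a"
        define b' where "b' = far (?E Rgt) w \<cdot>\<^bsub>C\<^esub> b"
        have a': "a' \<in> hom C s (fob (?E Lft) k)" "ncomp (\<gamma> k) Lft \<cdot>\<^bsub>C\<^esub> a' = \<pi> F Lft \<cdot>\<^bsub>C\<^esub> f"
          using push[OF k(2) i(2)] i(3) by (simp_all add: a'_def)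
        have b': "b' \<in> hom C s (fob (?E Rgt) k)" "ncomp (\<gamma> k) Rgt \<cdot>\<^bsub>C\<^esub> b' = \<pi> F Rgt \<cdot>\<^bsub>C\<^esub> f"
          using push[OF k(3) j(2)] j(3) by (simp_all add: b'_def)
        note Gk = Gj[OF k(1)]
        have leg: "far (fob G k) (x, Mid) \<cdot>\<^bsub>C\<^esub> c \<in> hom C s (fob (?E Mid) k)"
          "ncomp (\<gamma> k) Mid \<cdot>\<^bsub>C\<^esub> (far (fob G k) (x, Mid) \<cdot>\<^bsub>C\<^esub> c) = \<pi> F Mid \<cdot>\<^bsub>C\<^esub> f"
          if x: "(x, Mid) \<in> hom \<Lambda> x Mid" and c: "c \<in> hom C s (fob (?E x) k)"
            and eq: "ncomp (\<gamma> k) x \<cdot>\<^bsub>C\<^esub> c = \<pi> F x \<cdot>\<^bsub>C\<^esub> f" for x c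
        proof -
          note c' = c[unfolded fobE[OF k(1)]]
          show "far (fob G k) (x, Mid) \<cdot>\<^bsub>C\<^esub> c \<in> hom C s (fob (?E Mid) k)"
            using C.cmp_hom[OF c' is_functorD(4)[OF Gk x]] fobE[OF k(1)] by simp
          show "ncomp (\<gamma> k) Mid \<cdot>\<^bsub>C\<^esub> (far (fob G k) (x, Mid) \<cdot>\<^bsub>C\<^esub> c) = \<pi> F Mid \<cdot>\<^bsub>C\<^esub> f"
            using C.cmp_assoc[OF c' is_functorD(4)[OF Gk x] \<gamma>x[OF k(1)]]
              hom_FunD(4)[OF \<gamma>[OF k(1)] x] C.cmp_assoc[OF c' \<gamma>x[OF k(1)] is_functorD(4)[OF F x]]
              C.cmp_assoc[OF f proj_hom[OF F] is_functorD(4)[OF F x]] proj_cone[OF F x] eq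
            by simp
        qed
        \<comment> \<open>At stage \<open>k\<close> the maps \<open>a'\<close> and \<open>b'\<close>
          need not form a cone: their composites into the vertex \<open>Mid\<close> are only known
          to agree in the colimit. Compactness of \<open>s\<close> makes them agree at a later stage
          \<open>n\<close>, where they induce a map into the pullback.\<close>
        obtain n u where u: "u \<in> hom J k n"
          "far (?E Mid) u \<cdot>\<^bsub>C\<^esub> (far (fob G k) (Lft, Mid) \<cdot>\<^bsub>C\<^esub> a')
            = far (?E Mid) u \<cdot>\<^bsub>C\<^esub> (far (fob G k) (Rgt, Mid) \<cdot>\<^bsub>C\<^esub> b')"
          using equal[OF k(1) leg(1)[OF hom_cospan_cat(1) a'] leg(1)[OF hom_cospan_cat(2) b']
              trans[OF leg(2)[OF hom_cospan_cat(1) a'] leg(2)[OF hom_cospan_cat(2) b', symmetric]]]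
          by blast
        note n = J.hom_tgt_Ob[OF u(1)]
        note Gn = Gj[OF n]
        have legu: "far (fob G n) (x, Mid) \<cdot>\<^bsub>C\<^esub> (far (?E x) u \<cdot>\<^bsub>C\<^esub> c)
            = far (?E Mid) u \<cdot>\<^bsub>C\<^esub> (far (fob G k) (x, Mid) \<cdot>\<^bsub>C\<^esub> c)"
          if x: "(x, Mid) \<in> hom \<Lambda> x Mid" and c: "c \<in> hom C s (fob (?E x) k)" for x c
        proof -
          note c' = c[unfolded fobE[OF k(1)]]
          note Gu = is_functorD(4)[OF G u(1)]
          show ?thesis
            using C.cmp_assoc[OF c' hom_FunD(3)[OF Gu Ob_cospan_cat] is_functorD(4)[OF Gn x]]
              C.cmp_assoc[OF c' is_functorD(4)[OF Gk x] hom_FunD(3)[OF Gu Ob_cospan_cat]]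
              hom_FunD(4)[OF Gu x]
            by (simp add: eval_diagram_simps(2)[OF u(1)])
        qed
        obtain g where g: "g \<in> hom C s (fob P (fob G n))"
          "\<pi> (fob G n) Lft \<cdot>\<^bsub>C\<^esub> g = far (?E Lft) u \<cdot>\<^bsub>C\<^esub> a'"
          "\<pi> (fob G n) Rgt \<cdot>\<^bsub>C\<^esub> g = far (?E Rgt) u \<cdot>\<^bsub>C\<^esub> b'"
          using pullback_factor[OF Gn push(1)[OF u(1) a'(1), unfolded fobE[OF n]]
              push(1)[OF u(1) b'(1), unfolded fobE[OF n]]]
            legu[OF hom_cospan_cat(1) a'(1)] legu[OF hom_cospan_cat(2) b'(1)] u(2) by auto
        have "far P (\<gamma> n) \<cdot>\<^bsub>C\<^esub> g = f"
          by (rule pullback_eqI[OF F C.cmp_hom[OF g(1) P_far[OF \<gamma>[OF n]]] f])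
            (simp_all add: proj_\<gamma>[OF n g(1)] g(2,3) push(2)[OF u(1) a'(1)] push(2)[OF u(1) b'(1)] a'(2) b'(2))
        then show "\<exists>k\<in>Ob J. \<exists>g\<in>hom C s (fob ?K k). far P (\<gamma> k) \<cdot>\<^bsub>C\<^esub> g = f"
          using n g(1) fobK[OF n] by metis
      }
      fix k g g' assume k: "k \<in> Ob J" and "g \<in> hom C s (fob ?K k)" "g' \<in> hom C s (fob ?K k)"
        and eq: "far P (\<gamma> k) \<cdot>\<^bsub>C\<^esub> g = far P (\<gamma> k) \<cdot>\<^bsub>C\<^esub> g'"
      then have g: "g \<in> hom C s (fob P (fob G k))" "g' \<in> hom C s (fob P (fob G k))"
        using fobK[OF k] by simp_all
      have pg: "\<pi> (fob G k) x \<cdot>\<^bsub>C\<^esub> g \<in> hom C s (fob (?E x) k)"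
        "\<pi> (fob G k) x \<cdot>\<^bsub>C\<^esub> g' \<in> hom C s (fob (?E x) k)" for x
        using C.cmp_hom[OF g(1) proj_hom[OF Gj[OF k]]] C.cmp_hom[OF g(2) proj_hom[OF Gj[OF k]]]
          fobE[OF k] by simp_all
      have eqx: "ncomp (\<gamma> k) x \<cdot>\<^bsub>C\<^esub> (\<pi> (fob G k) x \<cdot>\<^bsub>C\<^esub> g) = ncomp (\<gamma> k) x \<cdot>\<^bsub>C\<^esub> (\<pi> (fob G k) x \<cdot>\<^bsub>C\<^esub> g')" for x
        using proj_\<gamma>[OF k g(1), of x] proj_\<gamma>[OF k g(2), of x] eq by simp
      obtain m v where v: "v \<in> hom J k m" "far (?E Lft) v \<cdot>\<^bsub>C\<^esub> (\<pi> (fob G k) Lft \<cdot>\<^bsub>C\<^esub> g)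
          = far (?E Lft) v \<cdot>\<^bsub>C\<^esub> (\<pi> (fob G k) Lft \<cdot>\<^bsub>C\<^esub> g')"
        using equal[OF k pg eqx] by blast
      obtain n w where w: "w \<in> hom J k n" "far (?E Rgt) w \<cdot>\<^bsub>C\<^esub> (\<pi> (fob G k) Rgt \<cdot>\<^bsub>C\<^esub> g)
          = far (?E Rgt) w \<cdot>\<^bsub>C\<^esub> (\<pi> (fob G k) Rgt \<cdot>\<^bsub>C\<^esub> g')"
        using equal[OF k pg eqx] by blast
      \<comment> \<open>The arrows \<open>v\<close> and \<open>w\<close> equalize the left and the
        right projections separately. Completing them to a commutative square yields a single arrow
        out of \<open>k\<close>, read as \<open>a\<close> after \<open>v\<close> on the left and as
        \<open>b\<close> after \<open>w\<close> on the right.\<close>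
      obtain r a b where ab: "a \<in> hom J m r" "b \<in> hom J n r" "a \<cdot>\<^bsub>J\<^esub> v = b \<cdot>\<^bsub>J\<^esub> w"
        using filtered_span[OF \<kappa>' J(2) v(1) w(1)] by blast
      let ?u = "a \<cdot>\<^bsub>J\<^esub> v"
      have u: "?u \<in> hom J k r" by (rule J.cmp_hom[OF v(1) ab(1)])
      have far_u: "far (?E x) (c \<cdot>\<^bsub>J\<^esub> t) \<cdot>\<^bsub>C\<^esub> y = far (?E x) c \<cdot>\<^bsub>C\<^esub> (far (?E x) t \<cdot>\<^bsub>C\<^esub> y)"
        if t: "t \<in> hom J k q" and c: "c \<in> hom J q r" and y: "y \<in> hom C s (fob (?E x) k)" for x c t q y
        using is_functorD(6)[OF E t c] C.cmp_assoc[OF y is_functorD(4)[OF E t] is_functorD(4)[OF E c]] by simp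
      note Gr = Gj[OF J.hom_tgt_Ob[OF u]]
      note Pu = P_far[OF is_functorD(4)[OF G u]]
      have "far P (far G ?u) \<cdot>\<^bsub>C\<^esub> g = far P (far G ?u) \<cdot>\<^bsub>C\<^esub> g'"
      proof (rule pullback_eqI[OF Gr C.cmp_hom[OF g(1) Pu] C.cmp_hom[OF g(2) Pu]])
        show "\<pi> (fob G r) Lft \<cdot>\<^bsub>C\<^esub> (far P (far G ?u) \<cdot>\<^bsub>C\<^esub> g)
          = \<pi> (fob G r) Lft \<cdot>\<^bsub>C\<^esub> (far P (far G ?u) \<cdot>\<^bsub>C\<^esub> g')"
          by (simp add: proj_u[OF u g(1)] proj_u[OF u g(2)] far_u[OF v(1) ab(1) pg(1)]
              far_u[OF v(1) ab(1) pg(2)] v(2))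
        show "\<pi> (fob G r) Rgt \<cdot>\<^bsub>C\<^esub> (far P (far G ?u) \<cdot>\<^bsub>C\<^esub> g)
          = \<pi> (fob G r) Rgt \<cdot>\<^bsub>C\<^esub> (far P (far G ?u) \<cdot>\<^bsub>C\<^esub> g')"
          unfolding proj_u[OF u g(1)] proj_u[OF u g(2)]
          unfolding ab(3)
          by (simp add: far_u[OF w(1) ab(2) pg(1)] far_u[OF w(1) ab(2) pg(2)] w(2))
      qed
      then show "\<exists>m. \<exists>u\<in>hom J k m. far ?K u \<cdot>\<^bsub>C\<^esub> g = far ?K u \<cdot>\<^bsub>C\<^esub> g'"
        using u farK[OF u] by metis
    qed
  qed
  then show ?thesis using P \<kappa> unfolding accessible_functor_def by blast
qed

section \<open>Well-orders as categories\<close>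

text \<open>
  The pairs in the order relation are the arrows. They are coded in \<open>'u\<close> by an injection \<open>p\<close>,
  because small index categories have their arrows in \<open>'u\<close>.
\<close>

definition order_cat :: "('u \<times> 'u \<Rightarrow> 'u) \<Rightarrow> 'u rel \<Rightarrow> ('u, 'u) cat" where
  "order_cat p r = \<lparr>Ob = Field r, Ar = p ` r, src = (\<lambda>u. fst (inv p u)), tgt = (\<lambda>u. snd (inv p u)),
     ide = (\<lambda>x. p (x, x)), cmp = (\<lambda>v u. p (fst (inv p u), snd (inv p v)))\<rparr>"

lemma Ob_order_cat [simp]: "Ob (order_cat p r) = Field r"
  by (simp add: order_cat_def)

lemma Ar_order_cat: "Ar (order_cat p r) = p ` r"
  by (simp add: order_cat_def)

lemma hom_order_cat_iff:
  assumes "inj p"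
  shows "u \<in> hom (order_cat p r) x y \<longleftrightarrow> u = p (x, y) \<and> (x, y) \<in> r"
  using inv_f_f[OF assms] by (auto simp: hom_def order_cat_def)

lemma cmp_order_cat:
  assumes "inj p"
  shows "p (y', z) \<cdot>\<^bsub>order_cat p r\<^esub> p (x, y) = p (x, z)"
  using inv_f_f[OF assms] by (simp add: order_cat_def)

lemma category_order_cat:
  assumes p: "inj p" and r: "Well_order r"
  shows "category (order_cat p r)"
proof -
  have refl: "(x, x) \<in> r" if "x \<in> Field r" for x
    using r that by (auto simp: order_on_defs refl_on_def)
  have trans: "(x, z) \<in> r" if "(x, y) \<in> r" "(y, z) \<in> r" for x y z
    using r that unfolding order_on_defs by (meson transD)
  show ?thesis
    using refl trans inv_f_f[OF p]
    by unfold_locales (auto simp: hom_order_cat_iff[OF p] cmp_order_cat[OF p],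
        auto simp: order_cat_def Field_def)
qed

lemma small_order_cat:
  assumes p: "inj p" and r: "regular_cardinal r" "r <o U"
  shows "small_cat U (order_cat p r)"
proof -
  have r': "Card_order r" "infinite (Field r)" using r by (auto simp: regular_cardinal_def)
  have "|p ` r| \<le>o |r|" by (rule card_of_image)
  also have "|r| \<le>o |Field r \<times> Field r|" by (rule card_of_mono1) (auto simp: Field_def)
  also have "|Field r \<times> Field r| =o |Field r|" using r'(2) by (rule card_of_Times_same_infinite)
  also have "|Field r| =o r" using r'(1) by (rule card_of_Field_ordIso)
  also have "r <o U" by fact
  finally have "|p ` r| <o U" .
  then show ?thesis
    using category_order_cat[OF p] r'(1)
    by (simp add: small_cat_def Ar_order_cat card_order_on_well_order_on)
qed

text \<open>By regularity a set of fewer than \<open>r\<close> elements is not cofinal, and totality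
  turns an element that witnesses this into an upper bound. In an order an upper bound of the
  objects is already a cocone. Allowing \<kappa> below \<open>r\<close> makes one order filtered for
  several cardinals at once.\<close>

lemma filtered_order_cat:
  fixes \<kappa> r :: "'u rel"
  assumes p: "inj p" and r: "regular_cardinal r" and \<kappa>: "\<kappa> \<le>o r"
  shows "filtered_cat \<kappa> (order_cat p r)"
  unfolding filtered_cat_def
proof (intro conjI allI impI; (elim conjE)?)
  have r': "Well_order r"
    using r by (simp add: regular_cardinal_def card_order_on_well_order_on)
  show "category (order_cat p r)" by (rule category_order_cat[OF p r'])
  fix A :: "('u, 'u) cat" and D
  assume A: "small_cat \<kappa> A" and D: "is_functor A (order_cat p r) D"
  interpret A: category A using is_functorD(1)[OF D] .
  let ?K = "fob D ` Ob A"
  have K: "?K \<subseteq> Field r" using is_functorD(3)[OF D] by auto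
  \<comment> \<open>Smallness bounds the arrows of \<open>A\<close>; identities carry that bound
    over to its objects and so to the image \<open>?K\<close>.\<close>
  have "inj_on (ide A) (Ob A)" "ide A ` Ob A \<subseteq> Ar A"
    using A.ide_hom by (auto simp: hom_iff intro: inj_on_inverseI[of _ "src A"])
  then have "|Ob A| \<le>o |Ar A|" using card_of_ordLeqI by blast
  then have "|?K| \<le>o |Ar A|" using card_of_image ordLeq_transitive by blast
  also have "|Ar A| <o \<kappa>" using A by (simp add: small_cat_def)
  also have "\<kappa> \<le>o r" by fact
  finally have "|?K| <o r" .
  then have "\<not> |?K| =o r" by (rule not_ordLess_ordIso)
  moreover have "?K \<subseteq> Field r \<and> cofinal ?K r \<longrightarrow> |?K| =o r"
    using r unfolding regular_cardinal_def regularCard_def by simp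
  ultimately have "\<not> cofinal ?K r" using K by simp
  then obtain a where a: "a \<in> Field r" "\<And>b. b \<in> ?K \<Longrightarrow> a = b \<or> (a, b) \<notin> r"
    unfolding cofinal_def by blast
  have b: "(b, a) \<in> r" if "b \<in> ?K" for b
  proof (cases "a = b")
    case True
    then show ?thesis using a(1) r' by (simp add: order_on_defs refl_on_def)
  next
    case False
    have "total_on (Field r) r" using r' by (simp add: order_on_defs)
    then show ?thesis using False a(2)[OF that] a(1) K that unfolding total_on_def by auto
  qed
  show "\<exists>j \<gamma>. is_cocone A (order_cat p r) D j \<gamma>"
  proof (intro exI is_coconeI)
    show "a \<in> Ob (order_cat p r)" using a by simp
    show "p (fob D j, a) \<in> hom (order_cat p r) (fob D j) a" if "j \<in> Ob A" for j
      using that b by (simp add: hom_order_cat_iff[OF p])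
    fix u i j assume "u \<in> hom A i j"
    then have "far D u = p (fob D i, fob D j)"
      using is_functorD(4)[OF D] hom_order_cat_iff[OF p] by blast
    then show "p (fob D j, a) \<cdot>\<^bsub>order_cat p r\<^esub> far D u = p (fob D i, a)"
      by (simp add: cmp_order_cat[OF p])
  qed
qed

definition order_functor :: "('u \<times> 'u \<Rightarrow> 'u) \<Rightarrow> 'u rel \<Rightarrow> ('u \<Rightarrow> 'o) \<Rightarrow> ('u \<Rightarrow> 'u \<Rightarrow> 'a) \<Rightarrow>
    ('u, 'u, 'o, 'a) cfunctor" where
  "order_functor p r F T = \<lparr>fob = restrict F (Field r),
     far = restrict (\<lambda>u. T (fst (inv p u)) (snd (inv p u))) (p ` r)\<rparr>"

lemma order_functor_simps:
  shows "x \<in> Field r \<Longrightarrow> fob (order_functor p r F T) x = F x"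
    and "inj p \<Longrightarrow> (x, y) \<in> r \<Longrightarrow> far (order_functor p r F T) (p (x, y)) = T x y"
  by (simp_all add: order_functor_def)

lemma is_functor_order_functor:
  assumes p: "inj p" and r: "Well_order r" and D: "category D"
    and F: "\<And>x. x \<in> Field r \<Longrightarrow> F x \<in> Ob D"
    and T: "\<And>x y. (x, y) \<in> r \<Longrightarrow> T x y \<in> hom D (F x) (F y)"
    and T_refl: "\<And>x. x \<in> Field r \<Longrightarrow> T x x = ide D (F x)"
    and T_trans: "\<And>x y z. (x, y) \<in> r \<Longrightarrow> (y, z) \<in> r \<Longrightarrow> T y z \<cdot>\<^bsub>D\<^esub> T x y = T x z"
  shows "is_functor (order_cat p r) D (order_functor p r F T)"
proof (rule is_functorI)
  have refl: "(x, x) \<in> r" if "x \<in> Field r" for x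
    using r that by (auto simp: order_on_defs refl_on_def)
  have trans: "(x, z) \<in> r" if "(x, y) \<in> r" "(y, z) \<in> r" for x y z
    using r that unfolding order_on_defs by (meson transD)
  show "category (order_cat p r)" by (rule category_order_cat[OF p r])
  show "category D" by fact
  show "fob (order_functor p r F T) \<in> extensional (Ob (order_cat p r))"
    "far (order_functor p r F T) \<in> extensional (Ar (order_cat p r))"
    by (simp_all add: order_functor_def Ar_order_cat)
  show "fob (order_functor p r F T) x \<in> Ob D" if "x \<in> Ob (order_cat p r)" for x
    using that F by (simp add: order_functor_simps)
  show "far (order_functor p r F T) (ide (order_cat p r) x) = ide D (fob (order_functor p r F T) x)"
    if "x \<in> Ob (order_cat p r)" for x
    using that T_refl refl by (simp add: order_functor_simps p order_cat_def)
  fix u x y assume "u \<in> hom (order_cat p r) x y"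
  then have u: "u = p (x, y)" "(x, y) \<in> r" by (auto simp: hom_order_cat_iff[OF p])
  then show "far (order_functor p r F T) u
      \<in> hom D (fob (order_functor p r F T) x) (fob (order_functor p r F T) y)"
    using T by (simp add: order_functor_simps p FieldI1 FieldI2)
  fix v z assume "v \<in> hom (order_cat p r) y z"
  then have v: "v = p (y, z)" "(y, z) \<in> r" by (auto simp: hom_order_cat_iff[OF p])
  show "far (order_functor p r F T) (v \<cdot>\<^bsub>order_cat p r\<^esub> u)
      = far (order_functor p r F T) v \<cdot>\<^bsub>D\<^esub> far (order_functor p r F T) u"
    using u v trans T_trans by (simp add: cmp_order_cat[OF p] order_functor_simps p)
qed

section \<open>Opposite categories\<close>

lemma opcat_simps [simp]:
  "Ob (opcat C) = Ob C" "Ar (opcat C) = Ar C" "src (opcat C) = tgt C" "tgt (opcat C) = src C"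
  "ide (opcat C) = ide C" "g \<cdot>\<^bsub>opcat C\<^esub> f = f \<cdot>\<^bsub>C\<^esub> g" "hom (opcat C) x y = hom C y x"
  by (auto simp: opcat_def hom_def)

lemma opcat_opcat: "opcat (opcat C) = (C :: ('o, 'a) cat)"
  by (simp add: opcat_def)

text \<open>A functor record has no variance built in, so one value can be read either way. This
  lets the same diagram of tails have a limit in \<open>C\<close>, given by completeness, and a
  colimit in \<open>opcat C\<close>, to which compactness applies.\<close>

lemma is_functor_opcat_iff:
  fixes C :: "('o, 'a) cat" and J :: "('j, 'i) cat"
  shows "is_functor (opcat J) C D \<longleftrightarrow> is_functor J (opcat C) D"
proof -
  have "category (opcat J) \<longleftrightarrow> category J" "category (opcat C) \<longleftrightarrow> category C"
    using category_opcat opcat_opcat by metis+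
  then show ?thesis by (auto simp: is_functor_def)
qed

lemma is_limit_opcat_iff: "is_limit (opcat J) C D c \<pi> \<longleftrightarrow> is_colimit J (opcat C) D c \<pi>"
  by (simp add: is_limit_def is_colimit_def is_cone_def is_cocone_def)

section \<open>Copowers\<close>

text \<open>\<open>Q A\<close> is the coproduct of copies of \<open>X\<close> indexed by
  \<open>A\<close>, chosen for all subsets of \<open>M\<close> simultaneously; functoriality in
  \<open>A\<close> is recovered afterwards by \<open>incl\<close>. In \<open>copair_ex\<close> the
  target needs its own membership condition, because for empty \<open>A\<close> the family
  \<open>t\<close> says nothing about \<open>Z\<close>.\<close>

locale copowers = category C for C :: "('o, 'a) cat" (structure) +
  fixes X :: 'o and M :: "'u set" and Q :: "'u set \<Rightarrow> 'o" and \<iota> :: "'u set \<Rightarrow> 'u \<Rightarrow> 'a"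
  assumes Q_Ob: "A \<subseteq> M \<Longrightarrow> Q A \<in> Ob C"
    and inj_hom: "A \<subseteq> M \<Longrightarrow> i \<in> A \<Longrightarrow> \<iota> A i \<in> hom C X (Q A)"
    and copair_ex: "A \<subseteq> M \<Longrightarrow> Z \<in> Ob C \<Longrightarrow> (\<And>i. i \<in> A \<Longrightarrow> t i \<in> hom C X Z) \<Longrightarrow>
      \<exists>h\<in>hom C (Q A) Z. \<forall>i\<in>A. h \<cdot> \<iota> A i = t i"
    and copair_eqI: "A \<subseteq> M \<Longrightarrow> h \<in> hom C (Q A) Z \<Longrightarrow> h' \<in> hom C (Q A) Z \<Longrightarrow>
      (\<And>i. i \<in> A \<Longrightarrow> h \<cdot> \<iota> A i = h' \<cdot> \<iota> A i) \<Longrightarrow> h = h'"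
begin

definition incl :: "'u set \<Rightarrow> 'u set \<Rightarrow> 'a" where
  "incl A B = (SOME h. h \<in> hom C (Q A) (Q B) \<and> (\<forall>i\<in>A. h \<cdot> \<iota> A i = \<iota> B i))"

lemma incl:
  assumes "A \<subseteq> B" "B \<subseteq> M"
  shows incl_hom: "incl A B \<in> hom C (Q A) (Q B)"
    and incl_inj: "i \<in> A \<Longrightarrow> incl A B \<cdot> \<iota> A i = \<iota> B i"
proof -
  have "\<exists>h\<in>hom C (Q A) (Q B). \<forall>i\<in>A. h \<cdot> \<iota> A i = \<iota> B i"
    using assms Q_Ob inj_hom by (intro copair_ex) auto
  then have "incl A B \<in> hom C (Q A) (Q B) \<and> (\<forall>i\<in>A. incl A B \<cdot> \<iota> A i = \<iota> B i)"
    unfolding incl_def by (rule_tac someI_ex) blast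
  then show "incl A B \<in> hom C (Q A) (Q B)" "i \<in> A \<Longrightarrow> incl A B \<cdot> \<iota> A i = \<iota> B i" by auto
qed

lemma cmp_incl_inj:
  assumes "A \<subseteq> B" "B \<subseteq> M" "h \<in> hom C (Q B) Z" "i \<in> A"
  shows "(h \<cdot> incl A B) \<cdot> \<iota> A i = h \<cdot> \<iota> B i"
  using cmp_assoc[OF inj_hom incl_hom[OF assms(1,2)] assms(3)] incl_inj[OF assms(1,2)] assms by auto

lemma cmp_incl_eqI:
  assumes AB: "A \<subseteq> B" "B \<subseteq> M" and h: "h \<in> hom C (Q B) Z" "h' \<in> hom C (Q A) Z"
    and eq: "\<And>i. i \<in> A \<Longrightarrow> h \<cdot> \<iota> B i = h' \<cdot> \<iota> A i"
  shows "h \<cdot> incl A B = h'"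
  by (rule copair_eqI[OF subset_trans[OF AB] cmp_hom[OF incl_hom[OF AB] h(1)] h(2)])
    (simp add: cmp_incl_inj[OF AB h(1)] eq)

lemma incl_cmp:
  assumes "A \<subseteq> B" "B \<subseteq> D" "D \<subseteq> M"
  shows "incl B D \<cdot> incl A B = incl A D"
proof (rule cmp_incl_eqI)
  show "A \<subseteq> B" "B \<subseteq> M" using assms by auto
  show "incl B D \<in> hom C (Q B) (Q D)" using assms by (intro incl_hom)
  show "incl A D \<in> hom C (Q A) (Q D)" using assms by (intro incl_hom) auto
  fix i assume "i \<in> A"
  then show "incl B D \<cdot> \<iota> B i = incl A D \<cdot> \<iota> A i"
    using assms incl_inj[of B D i] incl_inj[of A D i] by auto
qed

lemma incl_refl: "A \<subseteq> M \<Longrightarrow> incl A A = ide C (Q A)"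
  by (rule copair_eqI[of A _ "Q A"])
    (simp_all add: incl_hom incl_inj ide_hom Q_Ob ide_cmp[OF inj_hom])

end

lemma copowers_ex:
  fixes C :: "('o, 'a) cat" and U :: "'u rel" and M :: "'u set"
  assumes C: "category C" and cocompl: "cocomplete_cat U C" and X: "X \<in> Ob C" and M: "|M| <o U"
  shows "\<exists>Q \<iota>. copowers C X M Q \<iota>"
proof -
  interpret category C by fact
  define D where "D A = discrete_functor A C (\<lambda>_ :: 'u. X)" for A
  have D: "is_functor (discrete_cat A) C (D A)" for A :: "'u set"
    unfolding D_def by (rule is_functor_discrete[OF C X])
  have cocone_iff: "is_cocone (discrete_cat A) C (D A) c \<gamma> \<longleftrightarrow> c \<in> Ob C \<and> (\<forall>x\<in>A. \<gamma> x \<in> hom C X c)"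
    for A :: "'u set" and c \<gamma>
    unfolding D_def by (rule discrete_cocone_iff[OF C X])
  have "\<exists>c \<gamma>. is_colimit (discrete_cat A) C (D A) c \<gamma>" if "A \<subseteq> M" for A
  proof -
    have "|A| <o U" using card_of_mono1[OF that] M by (rule ordLeq_ordLess_trans)
    then have "small_cat U (discrete_cat A)" by (simp add: small_cat_def category_discrete)
    then show ?thesis using D cocompl unfolding cocomplete_cat_def by blast
  qed
  then obtain Q \<iota> where Q: "\<And>A. A \<subseteq> M \<Longrightarrow> is_colimit (discrete_cat A) C (D A) (Q A) (\<iota> A)"
    by metis
  note cocone = colimit_cocone[OF Q, unfolded cocone_iff]
  have "copowers C X M Q \<iota>"
  proof
    show "\<And>A. A \<subseteq> M \<Longrightarrow> Q A \<in> Ob C" "\<And>A i. A \<subseteq> M \<Longrightarrow> i \<in> A \<Longrightarrow> \<iota> A i \<in> hom C X (Q A)"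
      using cocone by blast+
    fix A Z
    assume A: "A \<subseteq> M"
    show "\<exists>h\<in>hom C (Q A) Z. \<forall>i\<in>A. h \<cdot>\<^bsub>C\<^esub> \<iota> A i = t i"
      if "Z \<in> Ob C" "\<And>i. i \<in> A \<Longrightarrow> t i \<in> hom C X Z" for t
    proof -
      have "is_cocone (discrete_cat A) C (D A) Z t" using that cocone_iff by blast
      from colimit_factor[OF Q[OF A] this] show ?thesis by (metis discrete_cat_simps(1))
    qed
    show "h = h'" if "h \<in> hom C (Q A) Z" "h' \<in> hom C (Q A) Z"
      "\<And>i. i \<in> A \<Longrightarrow> h \<cdot>\<^bsub>C\<^esub> \<iota> A i = h' \<cdot>\<^bsub>C\<^esub> \<iota> A i" for h h'
      using colimit_eqI[OF D Q[OF A] that(1,2)] that(3) by simp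
  qed
  then show ?thesis by blast
qed

section \<open>The telescope of copowers\<close>

locale telescope = copowers C X "Field \<mu>" Q \<iota>
  for C :: "('o, 'a) cat" (structure) and X and \<mu> :: "'u rel" and Q \<iota> +
  fixes p :: "'u \<times> 'u \<Rightarrow> 'u"
  assumes p: "inj p" and \<mu>: "regular_cardinal \<mu>"
begin

abbreviation M where "M \<equiv> Field \<mu>"
abbreviation W where "W \<equiv> order_cat p \<mu>"

text \<open>The closed tail \<open>up b\<close> and the half-open segment \<open>dn b\<close> are
  complementary in the order, so a map out of \<open>Q M\<close> can be prescribed independently on
  the two sides of \<open>b\<close>.\<close>

definition up :: "'u \<Rightarrow> 'u set" where "up a = {i. (a, i) \<in> \<mu>}"
definition dn :: "'u \<Rightarrow> 'u set" where "dn b = {i. (i, b) \<in> \<mu> \<and> i \<noteq> b}"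

lemma Well_order_\<mu>: "Well_order \<mu>"
  using \<mu> by (simp add: regular_cardinal_def card_order_on_well_order_on)

lemma order_refl: "x \<in> M \<Longrightarrow> (x, x) \<in> \<mu>"
  using Well_order_\<mu> by (auto simp: order_on_defs refl_on_def)

lemma order_trans: "(x, y) \<in> \<mu> \<Longrightarrow> (y, z) \<in> \<mu> \<Longrightarrow> (x, z) \<in> \<mu>"
  using Well_order_\<mu> unfolding order_on_defs by (meson transD)

lemma order_antisym: "(x, y) \<in> \<mu> \<Longrightarrow> (y, x) \<in> \<mu> \<Longrightarrow> x = y"
  using Well_order_\<mu> unfolding order_on_defs by (meson antisymD)

lemma order_total: "x \<in> M \<Longrightarrow> y \<in> M \<Longrightarrow> (x, y) \<in> \<mu> \<or> (y, x) \<in> \<mu>"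
  using Well_order_\<mu> order_refl unfolding order_on_defs total_on_def by metis

lemma up_subset: "up a \<subseteq> M" and dn_subset: "dn a \<subseteq> M"
  by (auto simp: up_def dn_def Field_def)

lemma up_antimono: "(a, b) \<in> \<mu> \<Longrightarrow> up b \<subseteq> up a"
  using order_trans by (auto simp: up_def)

lemma dn_mono: "(a, b) \<in> \<mu> \<Longrightarrow> dn a \<subseteq> dn b"
  using order_trans order_antisym by (auto simp: dn_def)

lemma dn_up_disjoint: "i \<in> dn b \<Longrightarrow> i \<notin> up b"
  using order_antisym by (auto simp: up_def dn_def)

text \<open>An infinite cardinal is a limit ordinal, so the segments exhaust \<open>M\<close>
  although each omits its own end point. This is what makes \<open>Q M\<close> the colimit of the
  copowers over the segments.\<close>

lemma ex_dn: "i \<in> M \<Longrightarrow> \<exists>b\<in>M. i \<in> dn b"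
  using infinite_Card_order_limit[of \<mu> i] \<mu> by (auto simp: regular_cardinal_def dn_def)

text \<open>For \<open>(a, b) \<in> \<mu>\<close> the inclusion goes from \<open>Q (up b)\<close> to
  \<open>Q (up a)\<close>, against the order; it is therefore an arrow of \<open>opcat C\<close>
  from stage \<open>a\<close> to stage \<open>b\<close>.\<close>

definition tails :: "('u, 'u, 'o, 'a) cfunctor" where
  "tails = order_functor p \<mu> (\<lambda>a. Q (up a)) (\<lambda>a b. incl (up b) (up a))"

lemma is_functor_tails: "is_functor W (opcat C) tails"
  unfolding tails_def
proof (rule is_functor_order_functor[OF p Well_order_\<mu>])
  show "category (opcat C)" by (rule category_opcat[OF category_axioms])
  show "incl (up z) (up y) \<cdot>\<^bsub>opcat C\<^esub> incl (up y) (up x) = incl (up z) (up x)"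
    if "(x, y) \<in> \<mu>" "(y, z) \<in> \<mu>" for x y z
    using incl_cmp[OF up_antimono[OF that(2)] up_antimono[OF that(1)] up_subset] by simp
qed (simp_all add: Q_Ob up_subset incl_hom up_antimono incl_refl)

end

text \<open>Set up for an arbitrary cone on the tails; universality of the cone enters later, when
  cocompactness of the target is applied.\<close>

locale telescope_cone = telescope C X \<mu> Q \<iota> p
  for C :: "('o, 'a) cat" (structure) and X and \<mu> :: "'u rel" and Q \<iota> p +
  fixes L :: 'o and \<rho> :: "'u \<Rightarrow> 'a"
  assumes cone: "is_cone (opcat W) C tails L \<rho>"
begin

lemma L_Ob: "L \<in> Ob C"
  using is_coneD(1)[OF cone] .

lemma \<rho>_hom: "a \<in> M \<Longrightarrow> \<rho> a \<in> hom C L (Q (up a))"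
  using is_coneD(2)[OF cone, of a] by (simp add: tails_def order_functor_simps)

lemma \<rho>_cone: "(a, b) \<in> \<mu> \<Longrightarrow> incl (up b) (up a) \<cdot> \<rho> b = \<rho> a"
  using is_coneD(3)[OF cone, of "p (a, b)" b a]
  by (simp add: hom_order_cat_iff[OF p] tails_def order_functor_simps p)

definition \<rho>' :: 'a where "\<rho>' = (let a = SOME a. a \<in> M in incl (up a) M \<cdot> \<rho> a)"

text \<open>Any two indices are comparable and \<rho> is a cone, so the composite does not depend on
  the index. Thus \<open>\<rho>'\<close> factors through every tail, the fact that later lets a map
  be changed on any proper initial segment without affecting its composite with
  \<open>\<rho>'\<close>.\<close>

lemma \<rho>'_eq:
  assumes "a \<in> M"
  shows "incl (up a) M \<cdot> \<rho> a = \<rho>'"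
proof -
  have step: "incl (up a) M \<cdot> \<rho> a = incl (up b) M \<cdot> \<rho> b" if ab: "(a, b) \<in> \<mu>" for a b
  proof -
    have "a \<in> M" "b \<in> M" using ab by (auto simp: Field_def)
    then show ?thesis
      using cmp_assoc[OF \<rho>_hom incl_hom[OF up_antimono[OF ab] up_subset] incl_hom[OF up_subset subset_refl]]
        \<rho>_cone[OF ab] incl_cmp[OF up_antimono[OF ab] up_subset subset_refl] by simp
  qed
  have "(SOME a. a \<in> M) \<in> M" using assms by (rule someI)
  then show ?thesis unfolding \<rho>'_def Let_def using step order_total[OF assms] by metis
qed

lemma \<rho>'_hom: "\<rho>' \<in> hom C L (Q M)"
proof -
  obtain a where a: "a \<in> M" using \<mu> by (auto simp: regular_cardinal_def dest: infinite_imp_nonempty)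
  show ?thesis
    using cmp_hom[OF \<rho>_hom[OF a] incl_hom[OF up_subset subset_refl]] \<rho>'_eq[OF a] by simp
qed

text \<open>Its pullback is the part of \<open>L\<close> that lies over the summands indexed by
  \<open>A\<close>. For \<open>A = M\<close> the right leg is an identity, so that pullback is
  \<open>L\<close> itself up to isomorphism.\<close>

definition head :: "'u set \<Rightarrow> (cospan_ob, cospan_ob \<times> cospan_ob, 'o, 'a) cfunctor" where
  "head A = cospan C L (Q M) (Q A) \<rho>' (incl A M)"

definition head_map :: "'u set \<Rightarrow> 'u set \<Rightarrow> (cospan_ob, cospan_ob \<times> cospan_ob, 'o, 'a) nattrans" where
  "head_map A B = \<lparr>nsrc = head A, ntgt = head B, ncomp = (\<lambda>x. case x of
       Lft \<Rightarrow> ide C L | Mid \<Rightarrow> ide C (Q M) | Rgt \<Rightarrow> incl A B)\<rparr>"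

lemma head_map_simps [simp]:
  "ncomp (head_map A B) Lft = ide C L" "ncomp (head_map A B) Mid = ide C (Q M)"
  "ncomp (head_map A B) Rgt = incl A B"
  by (simp_all add: head_map_def)

lemma head_simps [simp]:
  "fob (head A) Lft = L" "fob (head A) Mid = Q M" "fob (head A) Rgt = Q A"
  "far (head A) (Lft, Mid) = \<rho>'" "far (head A) (Rgt, Mid) = incl A M"
  by (simp_all add: head_def)

lemma is_functor_head: "A \<subseteq> M \<Longrightarrow> is_functor \<Lambda> C (head A)"
  unfolding head_def by (intro is_functor_cospan category_axioms \<rho>'_hom incl_hom) auto

lemma head_map_hom:
  assumes "A \<subseteq> B" "B \<subseteq> M"
  shows "head_map A B \<in> hom (Fun \<Lambda> C) (head A) (head B)"
  unfolding head_map_def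
proof (rule hom_cospanI)
  have A: "A \<subseteq> M" using assms by auto
  show "is_functor \<Lambda> C (head A)" "is_functor \<Lambda> C (head B)" using A assms is_functor_head by auto
  show "(case x of Lft \<Rightarrow> ide C L | Mid \<Rightarrow> ide C (Q M) | Rgt \<Rightarrow> incl A B)
      \<in> hom C (fob (head A) x) (fob (head B) x)" for x
    by (cases x) (simp_all add: ide_hom L_Ob Q_Ob incl_hom assms)
qed (simp_all add: ide_cmp[OF \<rho>'_hom] cmp_ide[OF \<rho>'_hom] incl_cmp assms
      ide_cmp[OF incl_hom[OF subset_trans[OF assms] subset_refl]])

definition heads :: "('u, 'u, (cospan_ob, cospan_ob \<times> cospan_ob, 'o, 'a) cfunctor,
    (cospan_ob, cospan_ob \<times> cospan_ob, 'o, 'a) nattrans) cfunctor" where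
  "heads = order_functor p \<mu> (\<lambda>b. head (dn b)) (\<lambda>b c. head_map (dn b) (dn c))"

lemma head_map_cmp:
  assumes "A \<subseteq> B" "B \<subseteq> D" "D \<subseteq> M"
  shows "head_map B D \<cdot>\<^bsub>Fun \<Lambda> C\<^esub> head_map A B = head_map A D"
proof (rule hom_Fun_eqI)
  interpret Fun: category "Fun \<Lambda> C" by (rule category_Fun[OF category_cospan category_axioms])
  show "head_map B D \<cdot>\<^bsub>Fun \<Lambda> C\<^esub> head_map A B \<in> hom (Fun \<Lambda> C) (head A) (head D)"
    using assms by (intro Fun.cmp_hom[OF head_map_hom head_map_hom]) auto
  show "head_map A D \<in> hom (Fun \<Lambda> C) (head A) (head D)"
    using assms by (intro head_map_hom) auto
  show "ncomp (head_map B D \<cdot>\<^bsub>Fun \<Lambda> C\<^esub> head_map A B) x = ncomp (head_map A D) x" for x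
    by (cases x) (simp_all add: ncomp_cmp incl_cmp assms ide_cmp[OF ide_hom] L_Ob Q_Ob)
qed

lemma head_map_refl:
  assumes "A \<subseteq> M"
  shows "head_map A A = ide (Fun \<Lambda> C) (head A)"
proof (rule hom_Fun_eqI)
  interpret Fun: category "Fun \<Lambda> C" by (rule category_Fun[OF category_cospan category_axioms])
  show "head_map A A \<in> hom (Fun \<Lambda> C) (head A) (head A)" using assms by (intro head_map_hom) auto
  show "ide (Fun \<Lambda> C) (head A) \<in> hom (Fun \<Lambda> C) (head A) (head A)"
    using is_functor_head[OF assms] by (intro Fun.ide_hom) (simp add: Ob_Fun)
  show "ncomp (head_map A A) x = ncomp (ide (Fun \<Lambda> C) (head A)) x" for x
    by (cases x) (simp_all add: ncomp_ide incl_refl assms)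
qed

lemma is_functor_heads: "is_functor W (Fun \<Lambda> C) heads"
  unfolding heads_def
  by (rule is_functor_order_functor[OF p Well_order_\<mu> category_Fun[OF category_cospan category_axioms]])
    (simp_all add: Ob_Fun is_functor_head dn_subset head_map_hom dn_mono head_map_refl head_map_cmp)

text \<open>At \<open>Lft\<close> and \<open>Mid\<close> the diagram is constant over a nonempty
  directed order; at \<open>Rgt\<close> the copower \<open>Q M\<close> is glued from the
  \<open>Q (dn b)\<close>, since the increasing segments cover \<open>M\<close>. The universal
  property is checked in the functor category itself.\<close>

lemma heads_colimit: "is_colimit W (Fun \<Lambda> C) heads (head M) (\<lambda>b. head_map (dn b) M)"
proof (rule is_colimitI)
  have dn_M: "dn b \<subseteq> M" for b by (rule dn_subset)
  interpret Fun: category "Fun \<Lambda> C" by (rule category_Fun[OF category_cospan category_axioms])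
  show "is_cocone W (Fun \<Lambda> C) heads (head M) (\<lambda>b. head_map (dn b) M)"
  proof (rule is_coconeI)
    show "head M \<in> Ob (Fun \<Lambda> C)" by (simp add: Ob_Fun is_functor_head)
    show "head_map (dn b) M \<in> hom (Fun \<Lambda> C) (fob heads b) (head M)" if "b \<in> Ob W" for b
      using that head_map_hom[OF dn_M subset_refl] by (simp add: heads_def order_functor_simps)
    show "head_map (dn c) M \<cdot>\<^bsub>Fun \<Lambda> C\<^esub> far heads u = head_map (dn b) M" if "u \<in> hom W b c" for u b c
      using that head_map_cmp[OF dn_mono dn_M subset_refl]
      by (auto simp: hom_order_cat_iff[OF p] heads_def order_functor_simps p)
  qed
  fix F
  {
    fix \<delta> assume \<delta>: "is_cocone W (Fun \<Lambda> C) heads F \<delta>"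
    have F: "is_functor \<Lambda> C F" using is_coconeD(1)[OF \<delta>] by (simp add: Ob_Fun)
    have \<delta>_hom: "\<delta> b \<in> hom (Fun \<Lambda> C) (head (dn b)) F" if "b \<in> M" for b
      using is_coconeD(2)[OF \<delta>, of b] that by (simp add: heads_def order_functor_simps)
    have \<delta>_cmp: "\<delta> c \<cdot>\<^bsub>Fun \<Lambda> C\<^esub> head_map (dn b) (dn c) = \<delta> b" if "(b, c) \<in> \<mu>" for b c
      using is_coconeD(3)[OF \<delta>, of "p (b, c)" b c] that
      by (simp add: hom_order_cat_iff[OF p] heads_def order_functor_simps p)
    have \<delta>x: "ncomp (\<delta> b) Lft \<in> hom C L (fob F Lft)" "ncomp (\<delta> b) Mid \<in> hom C (Q M) (fob F Mid)"
      "ncomp (\<delta> b) Rgt \<in> hom C (Q (dn b)) (fob F Rgt)" if "b \<in> M" for b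
      using hom_FunD(3)[OF \<delta>_hom[OF that], of Lft] hom_FunD(3)[OF \<delta>_hom[OF that], of Mid]
        hom_FunD(3)[OF \<delta>_hom[OF that], of Rgt] by simp_all
    have step: "ncomp (\<delta> b) Lft = ncomp (\<delta> c) Lft" "ncomp (\<delta> b) Mid = ncomp (\<delta> c) Mid"
      "i \<in> dn b \<Longrightarrow> ncomp (\<delta> b) Rgt \<cdot> \<iota> (dn b) i = ncomp (\<delta> c) Rgt \<cdot> \<iota> (dn c) i"
      if bc: "(b, c) \<in> \<mu>" for b c i
    proof -
      have c: "c \<in> M" using bc by (auto simp: Field_def)
      note cmp = ncomp_cmp[OF Ob_cospan_cat, of C "\<delta> c" "head_map (dn b) (dn c)", unfolded \<delta>_cmp[OF bc]]
      show "ncomp (\<delta> b) Lft = ncomp (\<delta> c) Lft" "ncomp (\<delta> b) Mid = ncomp (\<delta> c) Mid"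
        using cmp[of Lft] cmp[of Mid] by (simp_all add: cmp_ide[OF \<delta>x(1)[OF c]] cmp_ide[OF \<delta>x(2)[OF c]])
      show "ncomp (\<delta> b) Rgt \<cdot> \<iota> (dn b) i = ncomp (\<delta> c) Rgt \<cdot> \<iota> (dn c) i" if "i \<in> dn b"
        using cmp[of Rgt] cmp_incl_inj[OF dn_mono[OF bc] dn_M \<delta>x(3)[OF c] that] by simp
    qed
    have const: "ncomp (\<delta> b) Lft = ncomp (\<delta> c) Lft" "ncomp (\<delta> b) Mid = ncomp (\<delta> c) Mid"
      "i \<in> dn b \<Longrightarrow> i \<in> dn c \<Longrightarrow> ncomp (\<delta> b) Rgt \<cdot> \<iota> (dn b) i = ncomp (\<delta> c) Rgt \<cdot> \<iota> (dn c) i"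
      if "b \<in> M" "c \<in> M" for b c i
      using order_total[OF that] step[of b c] step[of c b] by metis+
    \<comment> \<open>\<open>a\<close> is an arbitrary stage for reading off the two constant
      components, and \<open>\<beta> i\<close> is a stage whose segment contains the summand
      \<open>i\<close>. By \<open>const\<close> neither choice affects the result.\<close>
    obtain a where a: "a \<in> M" using \<mu> by (auto simp: regular_cardinal_def dest: infinite_imp_nonempty)
    obtain \<beta> where \<beta>: "\<And>i. i \<in> M \<Longrightarrow> \<beta> i \<in> M" "\<And>i. i \<in> M \<Longrightarrow> i \<in> dn (\<beta> i)" using ex_dn by metis
    obtain k where k: "k \<in> hom C (Q M) (fob F Rgt)"
      "\<And>i. i \<in> M \<Longrightarrow> k \<cdot> \<iota> M i = ncomp (\<delta> (\<beta> i)) Rgt \<cdot> \<iota> (dn (\<beta> i)) i"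
    proof -
      have "\<exists>k\<in>hom C (Q M) (fob F Rgt). \<forall>i\<in>M. k \<cdot> \<iota> M i = ncomp (\<delta> (\<beta> i)) Rgt \<cdot> \<iota> (dn (\<beta> i)) i"
        using is_functorD(3)[OF F] cmp_hom[OF inj_hom[OF dn_M] \<delta>x(3)] \<beta>
        by (intro copair_ex) auto
      then show thesis using that by blast
    qed
    have k_incl: "k \<cdot> incl (dn b) M = ncomp (\<delta> b) Rgt" if b: "b \<in> M" for b
    proof (rule cmp_incl_eqI[OF dn_M subset_refl k(1) \<delta>x(3)[OF b]])
      fix i assume i: "i \<in> dn b"
      then have iM: "i \<in> M" using dn_M by blast
      show "k \<cdot> \<iota> M i = ncomp (\<delta> b) Rgt \<cdot> \<iota> (dn b) i"
        using k(2)[OF iM] const(3)[OF \<beta>(1)[OF iM] b \<beta>(2)[OF iM] i] by simp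
    qed
    let ?t = "\<lambda>x. case x of Lft \<Rightarrow> ncomp (\<delta> a) Lft | Mid \<Rightarrow> ncomp (\<delta> a) Mid | Rgt \<Rightarrow> k"
    let ?h = "\<lparr>nsrc = head M, ntgt = F, ncomp = ?t\<rparr>"
    note FR = is_functorD(4)[OF F hom_cospan_cat(2)]
    \<comment> \<open>Commutativity of the right square is tested on one summand \<open>i\<close> at
      a time, where it is inherited from the naturality of \<delta> at the stage
      \<open>\<beta> i\<close>.\<close>
    have "ncomp (\<delta> a) Mid = far F (Rgt, Mid) \<cdot> k"
    proof (rule copair_eqI[OF subset_refl \<delta>x(2)[OF a] cmp_hom[OF k(1) FR]])
      fix i assume i: "i \<in> M"
      note b = \<beta>[OF i]
      have "ncomp (\<delta> (\<beta> i)) Mid \<cdot> incl (dn (\<beta> i)) M = far F (Rgt, Mid) \<cdot> ncomp (\<delta> (\<beta> i)) Rgt"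
        using hom_FunD(4)[OF \<delta>_hom[OF b(1)] hom_cospan_cat(2)] by simp
      then show "ncomp (\<delta> a) Mid \<cdot> \<iota> M i = (far F (Rgt, Mid) \<cdot> k) \<cdot> \<iota> M i"
        using const(2)[OF a b(1)] cmp_incl_inj[OF dn_M subset_refl \<delta>x(2)[OF b(1)] b(2)]
          cmp_assoc[OF inj_hom[OF dn_M b(2)] \<delta>x(3)[OF b(1)] FR]
          cmp_assoc[OF inj_hom[OF subset_refl i] k(1) FR] k(2)[OF i] by simp
    qed
    then have "ncomp (\<delta> a) Mid \<cdot> incl M M = far F (Rgt, Mid) \<cdot> k"
      using cmp_ide[OF \<delta>x(2)[OF a]] by (simp add: incl_refl)
    moreover have "?t x \<in> hom C (fob (head M) x) (fob F x)" for x
      using \<delta>x[OF a] k(1) by (cases x) simp_all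
    ultimately have h: "?h \<in> hom (Fun \<Lambda> C) (head M) F"
      using hom_FunD(4)[OF \<delta>_hom[OF a] hom_cospan_cat(1)]
      by (intro hom_cospanI is_functor_head F) simp_all
    have "?h \<cdot>\<^bsub>Fun \<Lambda> C\<^esub> head_map (dn b) M = \<delta> b" if b: "b \<in> M" for b
    proof (rule hom_Fun_eqI[OF Fun.cmp_hom[OF head_map_hom[OF dn_M subset_refl] h] \<delta>_hom[OF b]])
      show "ncomp (?h \<cdot>\<^bsub>Fun \<Lambda> C\<^esub> head_map (dn b) M) x = ncomp (\<delta> b) x" for x
        using const(1,2)[OF a b] cmp_ide[OF \<delta>x(1)[OF b]] cmp_ide[OF \<delta>x(2)[OF b]] k_incl[OF b]
        by (cases x) (simp_all add: ncomp_cmp)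
    qed
    then show "\<exists>h\<in>hom (Fun \<Lambda> C) (head M) F. \<forall>b\<in>Ob W. h \<cdot>\<^bsub>Fun \<Lambda> C\<^esub> head_map (dn b) M = \<delta> b"
      using h by (intro bexI[of _ ?h]) simp_all
  }
  fix h h' assume h: "h \<in> hom (Fun \<Lambda> C) (head M) F" "h' \<in> hom (Fun \<Lambda> C) (head M) F"
    "\<forall>b\<in>Ob W. h \<cdot>\<^bsub>Fun \<Lambda> C\<^esub> head_map (dn b) M = h' \<cdot>\<^bsub>Fun \<Lambda> C\<^esub> head_map (dn b) M"
  have hx: "ncomp t Lft \<in> hom C L (fob F Lft)" "ncomp t Mid \<in> hom C (Q M) (fob F Mid)"
    "ncomp t Rgt \<in> hom C (Q M) (fob F Rgt)" if "t \<in> hom (Fun \<Lambda> C) (head M) F" for t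
    using hom_FunD(3)[OF that, of Lft] hom_FunD(3)[OF that, of Mid] hom_FunD(3)[OF that, of Rgt]
    by simp_all
  have eq: "ncomp h x \<cdot> ncomp (head_map (dn b) M) x = ncomp h' x \<cdot> ncomp (head_map (dn b) M) x"
    if "b \<in> M" for b x
    using h(3) that ncomp_cmp[OF Ob_cospan_cat, of C h "head_map (dn b) M" x]
      ncomp_cmp[OF Ob_cospan_cat, of C h' "head_map (dn b) M" x] by simp
  obtain a where a: "a \<in> M" using \<mu> by (auto simp: regular_cardinal_def dest: infinite_imp_nonempty)
  have "ncomp h Rgt = ncomp h' Rgt"
  proof (rule copair_eqI[OF subset_refl hx(3)[OF h(1)] hx(3)[OF h(2)]])
    fix i assume "i \<in> M"
    then obtain b where b: "b \<in> M" "i \<in> dn b" using ex_dn by blast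
    show "ncomp h Rgt \<cdot> \<iota> M i = ncomp h' Rgt \<cdot> \<iota> M i"
      using eq[OF b(1), of Rgt] cmp_incl_inj[OF dn_M subset_refl hx(3)[OF h(1)] b(2)]
        cmp_incl_inj[OF dn_M subset_refl hx(3)[OF h(2)] b(2)] by simp
  qed
  moreover have "ncomp h Lft = ncomp h' Lft" "ncomp h Mid = ncomp h' Mid"
    using eq[OF a, of Lft] eq[OF a, of Mid] cmp_ide[OF hx(1)] cmp_ide[OF hx(2)] h(1,2) by simp_all
  ultimately have "ncomp h x = ncomp h' x" for x by (cases x) simp_all
  then show "h = h'" using hom_Fun_eqI[OF h(1,2)] by blast
qed

text \<open>
  On the pullback of \<open>L\<close> with the summands below \<open>b\<close>, both composites agree with the one that uses
  \<open>f\<close> below \<open>b\<close> and \<open>g\<close> from \<open>b\<close> on, as the projection from \<open>L\<close> factors through the latter summands.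
\<close>

lemma codiagonals_agree:
  fixes U \<kappa> :: "'u rel"
  assumes pb: "pullback_functor C P \<pi>" and U: "\<mu> <o U"
    and pres: "preserves_filtered_colimits U \<kappa> (Fun \<Lambda> C) C P" and \<kappa>: "\<kappa> \<le>o \<mu>"
    and s: "s \<in> hom C (Q M) Y" "\<And>i. i \<in> M \<Longrightarrow> s \<cdot> \<iota> M i = f" and f: "f \<in> hom C X Y"
    and t: "t \<in> hom C (Q M) Y" "\<And>i. i \<in> M \<Longrightarrow> t \<cdot> \<iota> M i = g" and g: "g \<in> hom C X Y"
  shows "s \<cdot> \<rho>' = t \<cdot> \<rho>'"
proof -
  interpret pullback_functor C P \<pi> by fact
  have dn_M: "dn b \<subseteq> M" for b by (rule dn_subset)
  have col: "is_colimit W C (fcomp W P heads) (fob P (head M)) (\<lambda>b. far P (head_map (dn b) M))"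
    using pres small_order_cat[OF p \<mu> U] filtered_order_cat[OF p \<mu> \<kappa>] is_functor_heads heads_colimit
    unfolding preserves_filtered_colimits_def by blast
  have PW: "is_functor W C (fcomp W P heads)" by (rule is_functor_fcomp[OF is_functor_heads P])
  have hM: "is_functor \<Lambda> C (head M)" by (rule is_functor_head) simp
  have \<pi>M: "\<pi> (head M) Lft \<in> hom C (fob P (head M)) L" using proj_hom[OF hM, of Lft] by simp
  have s': "s \<cdot> \<rho>' \<in> hom C L Y" and t': "t \<cdot> \<rho>' \<in> hom C L Y"
    using cmp_hom[OF \<rho>'_hom] s t by auto
  \<comment> \<open>Here accessibility is used: \<open>fob P (head M)\<close> is the colimit of the
    pullbacks of the smaller heads, so maps out of it may be compared at each \<open>b\<close>
    separately.\<close>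
  have eq: "(s \<cdot> \<rho>') \<cdot> \<pi> (head M) Lft = (t \<cdot> \<rho>') \<cdot> \<pi> (head M) Lft"
  proof (rule colimit_eqI[OF PW col cmp_hom[OF \<pi>M s'] cmp_hom[OF \<pi>M t']])
    fix b assume "b \<in> Ob W"
    then have b: "b \<in> M" by simp
    have hb: "is_functor \<Lambda> C (head (dn b))" by (rule is_functor_head[OF dn_M])
    note m = head_map_hom[OF dn_M subset_refl, of b]
    let ?q = "\<pi> (head (dn b)) Lft" and ?r = "\<pi> (head (dn b)) Rgt"
    have q: "?q \<in> hom C (fob P (head (dn b))) L" and r: "?r \<in> hom C (fob P (head (dn b))) (Q (dn b))"
      using proj_hom[OF hb, of Lft] proj_hom[OF hb, of Rgt] by simp_all
    have nat: "\<pi> (head M) Lft \<cdot> far P (head_map (dn b) M) = ?q"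
      using proj_natural[OF m, of Lft] ide_cmp[OF q] by simp
    have square: "\<rho>' \<cdot> ?q = incl (dn b) M \<cdot> ?r"
      using proj_cone[OF hb hom_cospan_cat(1)] proj_cone[OF hb hom_cospan_cat(2)] by simp
    have "\<exists>h\<in>hom C (Q M) Y. \<forall>i\<in>M. h \<cdot> \<iota> M i = (if i \<in> dn b then f else g)"
      using f g by (intro copair_ex hom_tgt_Ob[OF f]) auto
    then obtain h where h: "h \<in> hom C (Q M) Y"
      "\<And>i. i \<in> M \<Longrightarrow> h \<cdot> \<iota> M i = (if i \<in> dn b then f else g)"
      by blast
    have incl_dn: "incl (dn b) M \<in> hom C (Q (dn b)) (Q M)" by (rule incl_hom[OF dn_M subset_refl])
    have incl_up: "incl (up b) M \<in> hom C (Q (up b)) (Q M)" by (rule incl_hom[OF up_subset subset_refl])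
    have "s \<cdot> incl (dn b) M = h \<cdot> incl (dn b) M"
      by (rule cmp_incl_eqI[OF dn_M subset_refl s(1) cmp_hom[OF incl_dn h(1)]])
        (simp add: cmp_incl_inj[OF dn_M subset_refl h(1)] s(2) h(2) subsetD[OF dn_M])
    moreover have "t \<cdot> incl (up b) M = h \<cdot> incl (up b) M"
      by (rule cmp_incl_eqI[OF up_subset subset_refl t(1) cmp_hom[OF incl_up h(1)]])
        (use dn_up_disjoint in \<open>auto simp: cmp_incl_inj[OF up_subset subset_refl h(1)] t(2) h(2)
            subsetD[OF up_subset]\<close>)
    \<comment> \<open>After the projection \<open>?q\<close>, \<open>\<rho>'\<close> factors through
      the segment, where \<open>s\<close> equals \<open>h\<close>; on all of \<open>L\<close> it
      factors through the tail, where \<open>h\<close> equals \<open>t\<close>.\<close>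
    ultimately have "s \<cdot> (\<rho>' \<cdot> ?q) = h \<cdot> (\<rho>' \<cdot> ?q)" "h \<cdot> \<rho>' = t \<cdot> \<rho>'"
      using cmp_assoc[OF r incl_dn s(1)] cmp_assoc[OF r incl_dn h(1)] square
        cmp_assoc[OF \<rho>_hom[OF b] incl_up t(1)] cmp_assoc[OF \<rho>_hom[OF b] incl_up h(1)] \<rho>'_eq[OF b]
      by simp_all
    then have "(s \<cdot> \<rho>') \<cdot> ?q = (t \<cdot> \<rho>') \<cdot> ?q"
      using cmp_assoc[OF q \<rho>'_hom s(1)] cmp_assoc[OF q \<rho>'_hom h(1)] cmp_assoc[OF q \<rho>'_hom t(1)] by simp
    then show "((s \<cdot> \<rho>') \<cdot> \<pi> (head M) Lft) \<cdot> far P (head_map (dn b) M)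
      = ((t \<cdot> \<rho>') \<cdot> \<pi> (head M) Lft) \<cdot> far P (head_map (dn b) M)"
      using cmp_assoc[OF is_functorD(4)[OF P m] \<pi>M s'] cmp_assoc[OF is_functorD(4)[OF P m] \<pi>M t'] nat
      by simp
  qed
  \<comment> \<open>The right leg of \<open>head M\<close> is an identity, so \<open>\<rho>'\<close>
    itself completes the identity of \<open>L\<close> to a cone. The induced section
    \<open>e\<close> cancels the projection in \<open>eq\<close>.\<close>
  obtain e where e: "e \<in> hom C L (fob P (head M))" "\<pi> (head M) Lft \<cdot> e = ide C L"
  proof -
    have "far (head M) (Lft, Mid) \<cdot> ide C L = far (head M) (Rgt, Mid) \<cdot> \<rho>'"
      by (simp add: cmp_ide[OF \<rho>'_hom] incl_refl ide_cmp[OF \<rho>'_hom])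
    then show thesis
      using pullback_factor[OF hM, of "ide C L" L \<rho>'] ide_hom[OF L_Ob] \<rho>'_hom that by auto
  qed
  show ?thesis
    using cmp_assoc[OF e(1) \<pi>M s'] cmp_assoc[OF e(1) \<pi>M t'] eq e(2) cmp_ide[OF s'] cmp_ide[OF t']
    by simp
qed

end

section \<open>Cocompact objects\<close>

theorem cocompact_subterminal:
  fixes U \<kappa> \<kappa>' :: "'u rel" and C :: "('o, 'a) cat"
  assumes C: "category C" and bi: "bicomplete U C" and pb: "is_pullback_functor C P"
    and \<kappa>: "small_regular U \<kappa>" and pres: "preserves_filtered_colimits U \<kappa> (Fun \<Lambda> C) C P"
    and \<kappa>': "small_regular U \<kappa>'" and Y: "cocompact_object U \<kappa>' C Y"
  shows "subterminal C Y"
  unfolding subterminal_def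
proof (intro conjI ballI)
  have cpt: "compact_object U \<kappa>' (opcat C) Y" using Y by (simp add: cocompact_object_def)
  then show Y_Ob: "Y \<in> Ob C" by (simp add: compact_object_def)
  \<comment> \<open>The larger of \<kappa> and \<open>\<kappa>'\<close>: the order \<mu> is then
    filtered for both, as needed for the pullbacks of heads and for the limit of tails.\<close>
  obtain \<mu> :: "'u rel" where \<mu>: "small_regular U \<mu>" and le: "\<kappa> \<le>o \<mu>" "\<kappa>' \<le>o \<mu>"
  proof -
    have "Well_order \<kappa>" "Well_order \<kappa>'"
      using \<kappa> \<kappa>' by (auto simp: small_regular_def regular_cardinal_def card_order_on_well_order_on)
    then show thesis using that \<kappa> \<kappa>' ordLeq_total ordLeq_reflexive by metis
  qed
  then have reg: "regular_cardinal \<mu>" and small: "\<mu> <o U" by (auto simp: small_regular_def)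
  have inf: "infinite (UNIV :: 'u set)" by (rule infinite_UNIV_regular[OF reg])
  obtain p :: "'u \<times> 'u \<Rightarrow> 'u" where p: "inj p"
    using ordIso_imp_ordLeq[OF card_of_Times_same_infinite[OF inf]]
    unfolding card_of_ordLeq[symmetric] by auto
  fix X f g assume X: "X \<in> Ob C" and f: "f \<in> hom C X Y" and g: "g \<in> hom C X Y"
  have "|Field \<mu>| <o U"
    using card_of_Field_ordIso[of \<mu>] reg small ordIso_ordLess_trans by (auto simp: regular_cardinal_def)
  then obtain Q \<iota> where "copowers C X (Field \<mu>) Q \<iota>"
    using copowers_ex[OF C _ X] bi unfolding bicomplete_def by blast
  then interpret copowers C X "Field \<mu>" Q \<iota> .
  interpret telescope C X \<mu> Q \<iota> p using p reg by unfold_locales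
  note W = small_order_cat[OF p reg small] filtered_order_cat[OF p reg le(2)]
  have "category (opcat W)" "|Ar (opcat W)| <o U"
    using W(1) category_opcat by (auto simp: small_cat_def)
  then have "small_cat U (opcat W)" by (simp add: small_cat_def)
  then obtain L \<rho> where L: "is_limit (opcat W) C tails L \<rho>"
    using bi is_functor_tails unfolding bicomplete_def complete_cat_def is_functor_opcat_iff[symmetric]
    by blast
  interpret telescope_cone C X \<mu> Q \<iota> p L \<rho> using limit_cone[OF L] by unfold_locales
  obtain \<pi> where \<pi>: "pullback_functor C P \<pi>" using pullback_functor_ex[OF pb] by blast
  obtain s where s: "s \<in> hom C (Q M) Y" "\<And>i. i \<in> M \<Longrightarrow> s \<cdot>\<^bsub>C\<^esub> \<iota> M i = f"
    using copair_ex[OF subset_refl Y_Ob, of "\<lambda>_. f"] f by blast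
  obtain t where t: "t \<in> hom C (Q M) Y" "\<And>i. i \<in> M \<Longrightarrow> t \<cdot>\<^bsub>C\<^esub> \<iota> M i = g"
    using copair_ex[OF subset_refl Y_Ob, of "\<lambda>_. g"] g by blast
  have agree: "s \<cdot>\<^bsub>C\<^esub> \<rho>' = t \<cdot>\<^bsub>C\<^esub> \<rho>'"
    by (rule codiagonals_agree[OF \<pi> small pres le(1) s f t g])
  obtain a where a: "a \<in> M" using reg by (auto simp: regular_cardinal_def dest: infinite_imp_nonempty)
  note up_M = incl_hom[OF up_subset subset_refl]
  \<comment> \<open>In \<open>opcat C\<close> the limit \<open>L\<close> is a colimit over
    \<open>W\<close>, and arrows from \<open>Y\<close> to the stage \<open>a\<close> are the arrows
    of \<open>C\<close> from \<open>Q (up a)\<close> to \<open>Y\<close>.\<close>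
  interpret compact_test U \<kappa>' "opcat C" W tails L \<rho> Y
    using \<kappa>' cpt W is_functor_tails L[unfolded is_limit_opcat_iff]
    by unfold_locales (auto simp: small_regular_def)
  have tail: "fob tails b = Q (up b)" if "b \<in> M" for b
    using that by (simp add: tails_def order_functor_simps)
  obtain b u where u: "u \<in> hom W a b"
    "far tails u \<cdot>\<^bsub>opcat C\<^esub> (s \<cdot>\<^bsub>C\<^esub> incl (up a) M) = far tails u \<cdot>\<^bsub>opcat C\<^esub> (t \<cdot>\<^bsub>C\<^esub> incl (up a) M)"
  proof (rule equal_at_stage)
    show "a \<in> Ob W" using a by simp
    show "s \<cdot>\<^bsub>C\<^esub> incl (up a) M \<in> hom (opcat C) Y (fob tails a)"
      "t \<cdot>\<^bsub>C\<^esub> incl (up a) M \<in> hom (opcat C) Y (fob tails a)"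
      using cmp_hom[OF up_M s(1)] cmp_hom[OF up_M t(1)] by (simp_all add: tail[OF a])
    show "\<rho> a \<cdot>\<^bsub>opcat C\<^esub> (s \<cdot>\<^bsub>C\<^esub> incl (up a) M) = \<rho> a \<cdot>\<^bsub>opcat C\<^esub> (t \<cdot>\<^bsub>C\<^esub> incl (up a) M)"
      using cmp_assoc[OF \<rho>_hom[OF a] up_M s(1)] cmp_assoc[OF \<rho>_hom[OF a] up_M t(1)] \<rho>'_eq[OF a] agree
      by simp
  qed blast
  then have ab: "u = p (a, b)" "(a, b) \<in> \<mu>" by (auto simp: hom_order_cat_iff[OF p])
  \<comment> \<open>The tail at \<open>b\<close> contains \<open>b\<close> itself. Hence at least
    one summand remains on which the restrictions of \<open>s\<close> and \<open>t\<close> can be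
    read off as \<open>f\<close> and \<open>g\<close>.\<close>
  then have b: "b \<in> up b" using order_refl by (auto simp: up_def Field_def)
  then have bM: "b \<in> M" using up_subset by blast
  note ba = up_antimono[OF ab(2)]
  have "s \<cdot>\<^bsub>C\<^esub> incl (up b) M = t \<cdot>\<^bsub>C\<^esub> incl (up b) M"
    using u(2) cmp_assoc[OF incl_hom[OF ba up_subset] up_M s(1)]
      cmp_assoc[OF incl_hom[OF ba up_subset] up_M t(1)] incl_cmp[OF ba up_subset subset_refl]
    by (simp add: ab tails_def order_functor_simps p)
  then show "f = g"
    using cmp_incl_inj[OF up_subset subset_refl s(1) b] cmp_incl_inj[OF up_subset subset_refl t(1) b]
      s(2)[OF bM] t(2)[OF bM] by simp
qed

text \<open>The first conjunct is the parenthetical example of the informal statement, the second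
  its main claim; both hold for an arbitrary choice \<open>pb\<close> of the pullback
  functor.\<close>

theorem theorem2p2:
  fixes U :: "'u rel"
    and C :: "('o, 'a) cat"
    and pb :: "((cospan_ob, cospan_ob \<times> cospan_ob, 'o, 'a) cfunctor,
                (cospan_ob, cospan_ob \<times> cospan_ob, 'o, 'a) nattrans, 'o, 'a) cfunctor"
  assumes "inaccessible U"
    and "category C"
    and "bicomplete U C"
    and "is_pullback_functor C pb"
  shows "(presentable U C \<longrightarrow> accessible_functor U (Fun \<Lambda> C) C pb)
    \<and> (accessible_functor U (Fun \<Lambda> C) C pb \<longrightarrow>
        (\<forall>\<kappa> Y. small_regular U \<kappa> \<and> cocompact_object U \<kappa> C Y \<longrightarrow> subterminal C Y))"
proof (intro conjI impI allI)
  show "accessible_functor U (Fun \<Lambda> C) C pb" if "presentable U C"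
    using presentable_pullback_accessible[OF _ _ assms(4) that] assms(1,3)
    by (simp add: inaccessible_def bicomplete_def)
  show "subterminal C Y"
    if "accessible_functor U (Fun \<Lambda> C) C pb" "small_regular U \<kappa> \<and> cocompact_object U \<kappa> C Y" for \<kappa> Y
    using that cocompact_subterminal[OF assms(2-4)] unfolding accessible_functor_def by blast
qed

end
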